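(* Let $p$ be a prime. Let $H$ and $K$ be conjugacy $p$-separable groups, let $A\leqslant H$ and $B\leqslant K$ be central subgroups (i.e. $A$ lies in the center of $H$ and $B$ lies in the center of $K$), and let $\varphi:A\to B$ be an isomorphism. Suppose every subgroup of $A$ of finite $p$-power index in $A$ is $p$-separable in $H$, and every subgroup of $B$ of finite $p$-power index in $B$ is $p$-separable in $K$. Then $G=\bigl(H*K;\ A=B,\ \varphi\bigr)$ is a conjugacy $p$-separable group.
   Context: $\bigl(H*K;\ A=B,\ \varphi\bigr)$ denotes the free product of $H$ and $K$ with subgroups $A$ and $B$ amalgamated via the isomorphism $\varphi$ (relations $a=a\varphi$, $a\in A$). A group $G$ is conjugacy $p$-separable if whenever $a,b\in G$ are not conjugate in $G$, there is a homomorphism $\psi$ of $G$ onto a finite $p$-group $X$ such that $a\psi$ and $b\psi$ are not conjugate in $X$. A subset $M$ of a group $Y$ is $p$-separable in $Y$ if for every $y\in Y$ with $y\notin M$ there is a homomorphism $\psi$ of $Y$ onto a finite $p$-group $X$ with $y\psi\notin M\psi$. A subgroup has finite $p$-index if its index is a (finite) power of $p$ (including index $1$). *)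

theory Defs
  imports "HOL-Algebra.Algebra"
begin

text \<open>A finite p-group. Every finite group is isomorphic to one whose carrier
consists of natural numbers, so quantifying over groups of type nat monoid
covers all finite quotients.\<close>
definition finite_p_group :: "nat \<Rightarrow> ('c, 'd) monoid_scheme \<Rightarrow> bool" where
  "finite_p_group p Q \<longleftrightarrow> group Q \<and> finite (carrier Q) \<and> (\<exists>n. card (carrier Q) = p ^ n)"

definition conj_in :: "('a, 'b) monoid_scheme \<Rightarrow> 'a \<Rightarrow> 'a \<Rightarrow> bool" where
  "conj_in G x y \<longleftrightarrow> (\<exists>g\<in>carrier G. y = inv\<^bsub>G\<^esub> g \<otimes>\<^bsub>G\<^esub> x \<otimes>\<^bsub>G\<^esub> g)"

definition conj_p_separable :: "nat \<Rightarrow> ('a, 'b) monoid_scheme \<Rightarrow> bool" where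
  "conj_p_separable p G \<longleftrightarrow> group G \<and>
     (\<forall>x\<in>carrier G. \<forall>y\<in>carrier G. \<not> conj_in G x y \<longrightarrow>
        (\<exists>(Q :: nat monoid) \<psi>. finite_p_group p Q \<and> \<psi> \<in> hom G Q \<and>
            \<psi> ` carrier G = carrier Q \<and> \<not> conj_in Q (\<psi> x) (\<psi> y)))"

definition p_separable_in :: "nat \<Rightarrow> ('a, 'b) monoid_scheme \<Rightarrow> 'a set \<Rightarrow> bool" where
  "p_separable_in p Y M \<longleftrightarrow>
     (\<forall>y\<in>carrier Y. y \<notin> M \<longrightarrow>
        (\<exists>(Q :: nat monoid) \<psi>. finite_p_group p Q \<and> \<psi> \<in> hom Y Q \<and>
            \<psi> ` carrier Y = carrier Q \<and> \<psi> y \<notin> \<psi> ` M))"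

definition finite_p_index_subgroup ::
  "nat \<Rightarrow> ('a, 'b) monoid_scheme \<Rightarrow> 'a set \<Rightarrow> 'a set \<Rightarrow> bool" where
  "finite_p_index_subgroup p H A C \<longleftrightarrow>
     subgroup C (H\<lparr>carrier := A\<rparr>) \<and>
     (\<exists>n. card (rcosets\<^bsub>H\<lparr>carrier := A\<rparr>\<^esub> C) = p ^ n)"

definition central_subgroup :: "('a, 'b) monoid_scheme \<Rightarrow> 'a set \<Rightarrow> bool" where
  "central_subgroup H A \<longleftrightarrow> subgroup A H \<and>
     (\<forall>a\<in>A. \<forall>h\<in>carrier H. a \<otimes>\<^bsub>H\<^esub> h = h \<otimes>\<^bsub>H\<^esub> a)"

definition amal_words :: "('a, 'c) monoid_scheme \<Rightarrow> ('b, 'd) monoid_scheme \<Rightarrow> ('a + 'b) list set" where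
  "amal_words H K = {w. \<forall>l\<in>set w. (case l of Inl h \<Rightarrow> h \<in> carrier H | Inr k \<Rightarrow> k \<in> carrier K)}"

inductive amal_basic :: "('a, 'c) monoid_scheme \<Rightarrow> ('b, 'd) monoid_scheme \<Rightarrow> 'a set \<Rightarrow> ('a \<Rightarrow> 'b)
    \<Rightarrow> ('a + 'b) list \<Rightarrow> ('a + 'b) list \<Rightarrow> bool"
  for H K A \<phi> where
  mult_H: "h1 \<in> carrier H \<Longrightarrow> h2 \<in> carrier H \<Longrightarrow>
      amal_basic H K A \<phi> [Inl h1, Inl h2] [Inl (h1 \<otimes>\<^bsub>H\<^esub> h2)]"
| mult_K: "k1 \<in> carrier K \<Longrightarrow> k2 \<in> carrier K \<Longrightarrow>
      amal_basic H K A \<phi> [Inr k1, Inr k2] [Inr (k1 \<otimes>\<^bsub>K\<^esub> k2)]"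
| one_H: "amal_basic H K A \<phi> [Inl \<one>\<^bsub>H\<^esub>] []"
| one_K: "amal_basic H K A \<phi> [Inr \<one>\<^bsub>K\<^esub>] []"
| amalg: "a \<in> A \<Longrightarrow> amal_basic H K A \<phi> [Inl a] [Inr (\<phi> a)]"

definition amal_step :: "('a, 'c) monoid_scheme \<Rightarrow> ('b, 'd) monoid_scheme \<Rightarrow> 'a set \<Rightarrow> ('a \<Rightarrow> 'b)
    \<Rightarrow> ('a + 'b) list \<Rightarrow> ('a + 'b) list \<Rightarrow> bool" where
  "amal_step H K A \<phi> u v \<longleftrightarrow>
     (\<exists>x y l r. x \<in> amal_words H K \<and> y \<in> amal_words H K \<and> amal_basic H K A \<phi> l r \<and>
        u = x @ l @ y \<and> v = x @ r @ y)"

definition amal_eq :: "('a, 'c) monoid_scheme \<Rightarrow> ('b, 'd) monoid_scheme \<Rightarrow> 'a set \<Rightarrow> ('a \<Rightarrow> 'b)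
    \<Rightarrow> ('a + 'b) list \<Rightarrow> ('a + 'b) list \<Rightarrow> bool" where
  "amal_eq H K A \<phi> = equivclp (amal_step H K A \<phi>)"

definition amal_class :: "('a, 'c) monoid_scheme \<Rightarrow> ('b, 'd) monoid_scheme \<Rightarrow> 'a set \<Rightarrow> ('a \<Rightarrow> 'b)
    \<Rightarrow> ('a + 'b) list \<Rightarrow> ('a + 'b) list set" where
  "amal_class H K A \<phi> w = {v. amal_eq H K A \<phi> w v}"

definition amal_prod :: "('a, 'c) monoid_scheme \<Rightarrow> ('b, 'd) monoid_scheme \<Rightarrow> 'a set \<Rightarrow> ('a \<Rightarrow> 'b)
    \<Rightarrow> ('a + 'b) list set monoid" where
  "amal_prod H K A \<phi> =
     \<lparr> carrier = amal_class H K A \<phi> ` amal_words H K,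
       monoid.mult = (\<lambda>U V. {w. \<exists>u\<in>U. \<exists>v\<in>V. amal_eq H K A \<phi> (u @ v) w}),
       one = amal_class H K A \<phi> [] \<rparr>"

end

theory Submission
  imports Defs
begin

text \<open>Let \<open>G\<close> be the amalgamated product. The main tool refines a given finite \<open>p\<close>-quotient
\<open>\<pi> : G \<rightarrow> P\<close>: with \<open>e\<close> the indicator function of \<open>\<pi> A\<close>, the group \<open>G\<close> maps to the wreath
product of \<open>\<int>/q\<close> by \<open>P\<close> by leaving \<open>H\<close> inside \<open>P\<close> and conjugating the image of \<open>K\<close> by \<open>e\<close>. The
function component of the image of a word \<open>s\<^sub>1 \<dots> s\<^sub>n\<close> is a signed sum of translates of \<open>e\<close> by the
images of those prefixes that border a syllable from \<open>K\<close>.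

If \<open>P\<close> separates the shorter subwords of a reduced word from \<open>A\<close>, one such translate does not cancel,
so the wreath product separates the word itself from \<open>A\<close>; hence \<open>G\<close> is residually a finite
\<open>p\<close>-group, and no normal form theorem is needed.

Let \<open>x\<close> be cyclically reduced of length at least two and not conjugate to \<open>y\<close>. Choose \<open>P\<close> such
that \<open>x\<close> differs in \<open>P\<close> from \<open>v\<^sup>-\<^sup>1 y v\<close> for all prefixes \<open>v\<close> of \<open>y\<close>, and such that \<open>x\<close> does not
commute in \<open>P\<close> with its prefixes ending in \<open>H\<close>. If the images of \<open>x\<close> and \<open>y\<close> were conjugate in the
wreath product, then comparing the sums of their function components over the centralizer of the
image of \<open>x\<close> in \<open>P\<close> would produce a prefix \<open>v\<close> with \<open>v\<^sup>-\<^sup>1 y v = x\<close> in \<open>P\<close>.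

Elements of \<open>H\<close> and \<open>K\<close> are separated in central products of finite \<open>p\<close>-quotients of the
factors.\<close>

subsection \<open>Finite p-quotients\<close>

definition p_quotient ::
  "nat \<Rightarrow> ('a, 'b) monoid_scheme \<Rightarrow> nat monoid \<Rightarrow> ('a \<Rightarrow> nat) \<Rightarrow> bool" where
  "p_quotient p Y Q \<psi> \<longleftrightarrow> finite_p_group p Q \<and> \<psi> \<in> hom Y Q \<and> \<psi> ` carrier Y = carrier Q"

lemma p_quotientD:
  assumes "p_quotient p Y Q \<psi>"
  shows "group Q" "finite (carrier Q)" "\<psi> \<in> hom Y Q" "\<psi> ` carrier Y = carrier Q"
    "finite_p_group p Q"
  using assms by (auto simp: p_quotient_def finite_p_group_def)

lemma p_quotient_group_hom:
  assumes "group Y" "p_quotient p Y Q \<psi>"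
  shows "group_hom Y Q \<psi>"
  using assms by (simp add: group_hom_def group_hom_axioms_def p_quotientD)

lemma finite_p_group_subgroup:
  assumes "Factorial_Ring.prime p" "finite_p_group p Q" "subgroup I Q"
  shows "finite_p_group p (Q\<lparr>carrier := I\<rparr>)"
proof -
  interpret group Q using assms(2) by (simp add: finite_p_group_def)
  obtain n where n: "card (carrier Q) = p ^ n" using assms(2) by (auto simp: finite_p_group_def)
  have "card (rcosets\<^bsub>Q\<^esub> I) * card I = p ^ n"
    using lagrange[OF assms(3)] n by (simp add: order_def)
  then have "card I dvd p ^ n" by (metis dvd_triv_right)
  then obtain i where "card I = p ^ i" using divides_primepow_nat[OF assms(1)] by blast
  moreover have "finite I"
    using assms(2,3) finite_subset subgroup.subset by (auto simp: finite_p_group_def)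
  ultimately show ?thesis
    using subgroup_imp_group[OF assms(3)] by (auto simp: finite_p_group_def)
qed

lemma finite_p_group_Mod:
  assumes "Factorial_Ring.prime p" "finite_p_group p Q" "N \<lhd> Q"
  shows "finite_p_group p (Q Mod N)"
proof -
  interpret normal N Q by fact
  obtain n where n: "card (carrier Q) = p ^ n" using assms(2) by (auto simp: finite_p_group_def)
  have "card (rcosets\<^bsub>Q\<^esub> N) * card N = p ^ n"
    using lagrange[OF subgroup_axioms] n by (simp add: order_def)
  then have "card (rcosets\<^bsub>Q\<^esub> N) dvd p ^ n" by (metis dvd_triv_left)
  then obtain i where "card (rcosets\<^bsub>Q\<^esub> N) = p ^ i" using divides_primepow_nat[OF assms(1)] by blast
  moreover have "finite (rcosets\<^bsub>Q\<^esub> N)"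
    using assms(2) by (auto simp: finite_p_group_def RCOSETS_def)
  ultimately show ?thesis
    using factorgroup_is_group by (auto simp: finite_p_group_def FactGroup_def)
qed

lemma finite_p_group_DirProd:
  assumes "finite_p_group p P" "finite_p_group p Q"
  shows "finite_p_group p (P \<times>\<times> Q)"
  using assms by (auto simp: finite_p_group_def DirProd_group card_cartesian_product
      simp flip: power_add)

text \<open>Direct products, factor groups and wreath products have carriers of other types, and
  maps into them need not be onto. The image is a subgroup, hence again a finite p-group, and its
  carrier can be renumbered by natural numbers. Neither change affects the fibres of
  \<open>\<psi>\<close>, through which separation is transferred later.\<close>

lemma p_quotient_exists:
  fixes Q :: "('x, 'y) monoid_scheme"
  assumes Y: "group Y" and p: "Factorial_Ring.prime p"
    and Q: "finite_p_group p Q" and \<psi>: "\<psi> \<in> hom Y Q"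
  obtains Q' \<psi>' where "p_quotient p Y Q' \<psi>'"
    "\<And>y z. y \<in> carrier Y \<Longrightarrow> z \<in> carrier Y \<Longrightarrow> \<psi>' y = \<psi>' z \<longleftrightarrow> \<psi> y = \<psi> z"
proof -
  have gQ: "group Q" using Q by (simp add: finite_p_group_def)
  interpret group_hom Y Q \<psi>
    using Y gQ \<psi> by (simp add: group_hom_def group_hom_axioms_def)
  define I where "I = \<psi> ` carrier Y"
  have I: "subgroup I Q" unfolding I_def by (rule img_is_subgroup)
  have fin: "finite_p_group p (Q\<lparr>carrier := I\<rparr>)" by (rule finite_p_group_subgroup[OF p Q I])
  then interpret I: group "Q\<lparr>carrier := I\<rparr>" by (simp add: finite_p_group_def)
  have fI: "finite I" using fin by (simp add: finite_p_group_def)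
  obtain f where f: "bij_betw f I {0..<card I}" using ex_bij_betw_finite_nat[OF fI] by blast
  define g where "g = inv_into I f"
  have gf: "g (f x) = x" if "x \<in> I" for x
    using that f unfolding g_def by (simp add: bij_betw_inv_into_left)
  define R where "R = \<lparr>carrier = {0..<card I}, monoid.mult = (\<lambda>a b. f (g a \<otimes>\<^bsub>Q\<^esub> g b)), one = f \<one>\<^bsub>Q\<^esub>\<rparr>"
  have iso: "f \<in> iso (Q\<lparr>carrier := I\<rparr>) R"
    using f by (auto simp: iso_def hom_def R_def gf bij_betw_def)
  have "group (R\<lparr>one := f \<one>\<^bsub>Q\<lparr>carrier := I\<rparr>\<^esub>\<rparr>)"
    by (rule I.iso_imp_img_group[OF iso])
  then have gR: "group R" by (simp add: R_def)
  have inj: "inj_on f I" using f by (simp add: bij_betw_def)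
  have "finite_p_group p R"
    using fin gR by (simp add: finite_p_group_def R_def)
  moreover have "(f \<circ> \<psi>) \<in> hom Y R"
  proof (rule homI)
    fix x y assume "x \<in> carrier Y" "y \<in> carrier Y"
    then show "(f \<circ> \<psi>) (x \<otimes>\<^bsub>Y\<^esub> y) = (f \<circ> \<psi>) x \<otimes>\<^bsub>R\<^esub> (f \<circ> \<psi>) y"
      by (simp add: R_def gf I_def)
  next
    fix x assume "x \<in> carrier Y"
    then show "(f \<circ> \<psi>) x \<in> carrier R" using iso by (auto simp: iso_def hom_def I_def)
  qed
  moreover have "(f \<circ> \<psi>) ` carrier Y = carrier R"
    using f by (simp only: image_comp[symmetric] I_def[symmetric] bij_betw_def) (simp add: R_def)
  ultimately have "p_quotient p Y R (f \<circ> \<psi>)" by (simp add: p_quotient_def)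
  moreover have "(f \<circ> \<psi>) y = (f \<circ> \<psi>) z \<longleftrightarrow> \<psi> y = \<psi> z"
    if "y \<in> carrier Y" "z \<in> carrier Y" for y z
    using that inj by (simp add: I_def inj_on_eq_iff)
  ultimately show thesis by (rule that)
qed

text \<open>Each pair comes with a quotient of its own. The product of two quotients keeps the
  separations achieved by either, since one differing coordinate suffices.\<close>

lemma p_quotient_separates_finite:
  assumes Y: "group Y" and p: "Factorial_Ring.prime p" and "finite F"
    and "\<And>y M. (y, M) \<in> F \<Longrightarrow> y \<in> carrier Y \<and> M \<subseteq> carrier Y \<and>
           (\<exists>Q \<psi>. p_quotient p Y Q \<psi> \<and> \<psi> y \<notin> \<psi> ` M)"
  shows "\<exists>Q \<psi>. p_quotient p Y Q \<psi> \<and> (\<forall>(y, M)\<in>F. \<psi> y \<notin> \<psi> ` M)"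
  using assms(3,4)
proof (induction F)
  case empty
  \<comment> \<open>Even the empty family demands a quotient; the trivial group on
    \<open>{0}\<close> serves.\<close>
  define T where "T = \<lparr>carrier = {0::nat}, monoid.mult = (\<lambda>_ _. 0), one = 0::nat\<rparr>"
  have "group T" by (rule groupI) (auto simp: T_def)
  then have "finite_p_group p T"
    unfolding finite_p_group_def by (auto simp: T_def intro: exI[of _ 0])
  moreover have "(\<lambda>_. 0) \<in> hom Y T" by (auto simp: hom_def T_def)
  moreover have "carrier Y \<noteq> {}" using group.is_monoid[OF Y] monoid.one_closed by fastforce
  ultimately show ?case
    by (intro exI[of _ T] exI[of _ "\<lambda>_. 0"]) (auto simp: p_quotient_def T_def)
next
  case (insert x F)
  obtain z N where x: "x = (z, N)" by fastforce
  obtain Q1 \<psi>1 where 1: "p_quotient p Y Q1 \<psi>1" "\<forall>(y, M)\<in>F. \<psi>1 y \<notin> \<psi>1 ` M"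
    using insert.IH[OF insert.prems, OF insertI2] by auto
  obtain Q2 \<psi>2 where 2: "p_quotient p Y Q2 \<psi>2" "\<psi>2 z \<notin> \<psi>2 ` N"
    using insert.prems[of z N] x by auto
  have h: "(\<lambda>y. (\<psi>1 y, \<psi>2 y)) \<in> hom Y (Q1 \<times>\<times> Q2)"
    using p_quotientD(3)[OF 1(1)] p_quotientD(3)[OF 2(1)] by (auto simp: hom_def DirProd_def)
  obtain Q \<psi> where Q: "p_quotient p Y Q \<psi>"
    "\<And>y z. y \<in> carrier Y \<Longrightarrow> z \<in> carrier Y \<Longrightarrow>
       \<psi> y = \<psi> z \<longleftrightarrow> (\<psi>1 y, \<psi>2 y) = (\<psi>1 z, \<psi>2 z)"
    using p_quotient_exists[OF Y p finite_p_group_DirProd[OF p_quotientD(5)[OF 1(1)]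
          p_quotientD(5)[OF 2(1)]] h] by blast
  have "\<psi> y \<notin> \<psi> ` M" if "(y, M) \<in> insert x F" for y M
  proof
    assume "\<psi> y \<in> \<psi> ` M"
    then obtain m where m: "m \<in> M" "\<psi> y = \<psi> m" by blast
    have "y \<in> carrier Y" "m \<in> carrier Y" using insert.prems[OF that] m by auto
    then have "\<psi>1 y = \<psi>1 m" "\<psi>2 y = \<psi>2 m" using Q(2)[of y m] m(2) by simp_all
    then show False using that m 1(2) 2(2) x by auto
  qed
  then show ?case using Q(1) by blast
qed

section \<open>Conjugacy and its separation in finite p-quotients\<close>

lemma (in group) conj_in_iff:
  assumes "x \<in> carrier G" "y \<in> carrier G"
  shows "conj_in G x y \<longleftrightarrow> (\<exists>g\<in>carrier G. g \<otimes> y = x \<otimes> g)"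
proof -
  have *: "y = inv g \<otimes> x \<otimes> g \<longleftrightarrow> g \<otimes> y = x \<otimes> g" if "g \<in> carrier G" for g
  proof
    assume "y = inv g \<otimes> x \<otimes> g"
    then have "g \<otimes> y = g \<otimes> (inv g \<otimes> x \<otimes> g)" by (rule arg_cong)
    also have "\<dots> = x \<otimes> g" using assms(1) that by (simp flip: m_assoc)
    finally show "g \<otimes> y = x \<otimes> g" .
  next
    assume "g \<otimes> y = x \<otimes> g"
    then have "inv g \<otimes> (g \<otimes> y) = inv g \<otimes> (x \<otimes> g)" by (rule arg_cong)
    then show "y = inv g \<otimes> x \<otimes> g" using assms that by (simp flip: m_assoc)
  qed
  show ?thesis unfolding conj_in_def
  proof
    assume "\<exists>g\<in>carrier G. y = inv g \<otimes> x \<otimes> g"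
    then obtain g where g: "g \<in> carrier G" "y = inv g \<otimes> x \<otimes> g" ..
    from *[OF g(1)] g(2) have "g \<otimes> y = x \<otimes> g" by (rule iffD1)
    with g(1) show "\<exists>g\<in>carrier G. g \<otimes> y = x \<otimes> g" ..
  next
    assume "\<exists>g\<in>carrier G. g \<otimes> y = x \<otimes> g"
    then obtain g where g: "g \<in> carrier G" "g \<otimes> y = x \<otimes> g" ..
    from *[OF g(1)] g(2) have "y = inv g \<otimes> x \<otimes> g" by (rule iffD2)
    with g(1) show "\<exists>g\<in>carrier G. y = inv g \<otimes> x \<otimes> g" ..
  qed
qed

lemma (in group) conj_in_sym:
  assumes "x \<in> carrier G" "y \<in> carrier G" "conj_in G x y"
  shows "conj_in G y x"
proof -
  obtain g where g: "g \<in> carrier G" "g \<otimes> y = x \<otimes> g" using assms conj_in_iff by blast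
  have "inv g \<otimes> x = inv g \<otimes> (x \<otimes> g) \<otimes> inv g"
    using assms g(1) by (simp add: m_assoc)
  also have "\<dots> = inv g \<otimes> (g \<otimes> y) \<otimes> inv g" using g(2) by simp
  also have "\<dots> = y \<otimes> inv g" using assms g(1) by (simp flip: m_assoc)
  finally show ?thesis using conj_in_iff assms g by blast
qed

lemma (in group) conj_in_trans:
  assumes "x \<in> carrier G" "y \<in> carrier G" "z \<in> carrier G" "conj_in G x y" "conj_in G y z"
  shows "conj_in G x z"
proof -
  obtain g where g: "g \<in> carrier G" "g \<otimes> y = x \<otimes> g" using assms conj_in_iff by blast
  obtain h where h: "h \<in> carrier G" "h \<otimes> z = y \<otimes> h" using assms conj_in_iff by blast
  have "(g \<otimes> h) \<otimes> z = x \<otimes> (g \<otimes> h)"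
    using assms g h m_assoc[of g h z] m_assoc[of g y h] m_assoc[of x g h] by simp
  then show ?thesis using conj_in_iff assms g h by blast
qed

lemma (in group) conj_in_refl: "x \<in> carrier G \<Longrightarrow> conj_in G x x"
  by (auto simp: conj_in_def intro!: bexI[of _ \<one>])

lemma (in group_hom) conj_in_hom:
  assumes "x \<in> carrier G" "y \<in> carrier G" "conj_in G x y"
  shows "conj_in H (h x) (h y)"
proof -
  obtain g where g: "g \<in> carrier G" "g \<otimes> y = x \<otimes> g" using assms G.conj_in_iff by blast
  then have "h g \<otimes>\<^bsub>H\<^esub> h y = h x \<otimes>\<^bsub>H\<^esub> h g" using assms hom_mult by metis
  then show ?thesis using H.conj_in_iff[of "h x" "h y"] assms g(1) by auto
qed

definition p_conj_separated ::
  "nat \<Rightarrow> ('a, 'b) monoid_scheme \<Rightarrow> 'a \<Rightarrow> 'a \<Rightarrow> bool" where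
  "p_conj_separated p G x y \<longleftrightarrow> (\<exists>Q \<psi>. p_quotient p G Q \<psi> \<and> \<not> conj_in Q (\<psi> x) (\<psi> y))"

lemma conj_p_separable_iff:
  "conj_p_separable p G \<longleftrightarrow> group G \<and>
     (\<forall>x\<in>carrier G. \<forall>y\<in>carrier G. \<not> conj_in G x y \<longrightarrow> p_conj_separated p G x y)"
  by (simp add: conj_p_separable_def p_conj_separated_def p_quotient_def conj_assoc)

lemma p_separable_in_iff:
  "p_separable_in p G M \<longleftrightarrow>
     (\<forall>y\<in>carrier G. y \<notin> M \<longrightarrow> (\<exists>Q \<psi>. p_quotient p G Q \<psi> \<and> \<psi> y \<notin> \<psi> ` M))"
  by (simp add: p_separable_in_def p_quotient_def conj_assoc)

text \<open>Separability of a pair depends only on the two conjugacy classes, so both elements may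
  later be replaced by convenient conjugates.\<close>

lemma p_conj_separated_cong:
  assumes "group G" "x \<in> carrier G" "y \<in> carrier G" "x' \<in> carrier G" "y' \<in> carrier G"
    and "conj_in G x x'" "conj_in G y y'" "p_conj_separated p G x' y'"
  shows "p_conj_separated p G x y"
proof -
  obtain Q \<psi> where Q: "p_quotient p G Q \<psi>" "\<not> conj_in Q (\<psi> x') (\<psi> y')"
    using assms by (auto simp: p_conj_separated_def)
  interpret group_hom G Q \<psi> by (rule p_quotient_group_hom[OF assms(1) Q(1)])
  have "\<not> conj_in Q (\<psi> x) (\<psi> y)"
  proof
    assume "conj_in Q (\<psi> x) (\<psi> y)"
    then have "conj_in Q (\<psi> x) (\<psi> y')"
      using conj_in_hom[OF _ _ assms(7)] assms by (blast intro: H.conj_in_trans hom_closed)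
    moreover have "conj_in Q (\<psi> x') (\<psi> x)"
      using conj_in_hom[OF _ _ assms(6)] assms by (blast intro: H.conj_in_sym hom_closed)
    ultimately show False using Q assms by (blast intro: H.conj_in_trans hom_closed)
  qed
  then show ?thesis using Q by (auto simp: p_conj_separated_def)
qed

lemma p_conj_separated_sym:
  assumes "group G" "x \<in> carrier G" "y \<in> carrier G" "p_conj_separated p G x y"
  shows "p_conj_separated p G y x"
proof -
  obtain Q \<psi> where Q: "p_quotient p G Q \<psi>" "\<not> conj_in Q (\<psi> x) (\<psi> y)"
    using assms by (auto simp: p_conj_separated_def)
  interpret group_hom G Q \<psi> by (rule p_quotient_group_hom[OF assms(1) Q(1)])
  show ?thesis using Q assms H.conj_in_sym unfolding p_conj_separated_def by (meson hom_closed)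
qed

text \<open>The target need not be the image: conjugacy in the image implies conjugacy in the target.\<close>
lemma p_conj_separatedI:
  assumes Y: "group Y" and p: "Factorial_Ring.prime p"
    and Q: "finite_p_group p Q" and \<psi>: "\<psi> \<in> hom Y Q"
    and xy: "x \<in> carrier Y" "y \<in> carrier Y" and nc: "\<not> conj_in Q (\<psi> x) (\<psi> y)"
  shows "p_conj_separated p Y x y"
proof -
  obtain Q' \<psi>' where q: "p_quotient p Y Q' \<psi>'" and
    eq: "\<And>y z. y \<in> carrier Y \<Longrightarrow> z \<in> carrier Y \<Longrightarrow> \<psi>' y = \<psi>' z \<longleftrightarrow> \<psi> y = \<psi> z"
    using p_quotient_exists[OF Y p Q \<psi>] by blast
  interpret A: group_hom Y Q' \<psi>' by (rule p_quotient_group_hom[OF Y q])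
  have "group Q" using Q by (simp add: finite_p_group_def)
  then interpret B: group_hom Y Q \<psi>
    by (intro group_hom.intro group_hom_axioms.intro Y \<psi>)
  have "\<not> conj_in Q' (\<psi>' x) (\<psi>' y)"
  proof
    assume "conj_in Q' (\<psi>' x) (\<psi>' y)"
    then obtain g' where g': "g' \<in> carrier Q'" "g' \<otimes>\<^bsub>Q'\<^esub> \<psi>' y = \<psi>' x \<otimes>\<^bsub>Q'\<^esub> g'"
      using A.H.conj_in_iff[of "\<psi>' x" "\<psi>' y"] xy by auto
    moreover from g'(1) obtain g where "g \<in> carrier Y" "g' = \<psi>' g"
      using p_quotientD(4)[OF q, symmetric] by auto
    ultimately have g: "g \<in> carrier Y" "\<psi>' g \<otimes>\<^bsub>Q'\<^esub> \<psi>' y = \<psi>' x \<otimes>\<^bsub>Q'\<^esub> \<psi>' g"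
      by simp_all
    then have "\<psi>' (g \<otimes>\<^bsub>Y\<^esub> y) = \<psi>' (x \<otimes>\<^bsub>Y\<^esub> g)" using xy by simp
    then have "\<psi> (g \<otimes>\<^bsub>Y\<^esub> y) = \<psi> (x \<otimes>\<^bsub>Y\<^esub> g)"
      using eq[of "g \<otimes>\<^bsub>Y\<^esub> y" "x \<otimes>\<^bsub>Y\<^esub> g"] xy g(1) by (simp del: A.hom_mult B.hom_mult)
    then have "\<psi> g \<otimes>\<^bsub>Q\<^esub> \<psi> y = \<psi> x \<otimes>\<^bsub>Q\<^esub> \<psi> g" using xy g(1) by simp
    then show False using nc B.H.conj_in_iff[of "\<psi> x" "\<psi> y"] xy g by auto
  qed
  then show ?thesis using q by (auto simp: p_conj_separated_def)
qed

subsection \<open>Central products of quotients\<close>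

lemma central_subgroupD:
  assumes "central_subgroup H A"
  shows "subgroup A H" "A \<subseteq> carrier H"
    "\<And>a h. a \<in> A \<Longrightarrow> h \<in> carrier H \<Longrightarrow> a \<otimes>\<^bsub>H\<^esub> h = h \<otimes>\<^bsub>H\<^esub> a"
  using assms subgroup.subset by (auto simp: central_subgroup_def)

text \<open>By the first isomorphism theorem the kernel has as many cosets as
  \<open>\<theta>\<close> has values, and the image is a subgroup of a finite p-group. This makes
  the separability hypothesis on subgroups of finite p-index applicable to kernels.\<close>

lemma kernel_finite_p_index:
  assumes p: "Factorial_Ring.prime p" and K: "group K" and B: "subgroup B K"
    and Q: "finite_p_group p Q" and \<theta>: "\<theta> \<in> hom (K\<lparr>carrier := B\<rparr>) Q"
  shows "finite_p_index_subgroup p K B {b \<in> B. \<theta> b = \<one>\<^bsub>Q\<^esub>}"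
proof -
  let ?B = "K\<lparr>carrier := B\<rparr>" and ?I = "Q\<lparr>carrier := \<theta> ` B\<rparr>"
  have gB: "group ?B" using K B by (rule group.subgroup_imp_group)
  have gQ: "group Q" using Q by (simp add: finite_p_group_def)
  interpret g: group_hom ?B Q \<theta>
    by (intro group_hom.intro group_hom_axioms.intro gB gQ \<theta>)
  have sI: "subgroup (\<theta> ` B) Q" using g.img_is_subgroup by simp
  have pI: "finite_p_group p ?I" by (rule finite_p_group_subgroup[OF p Q sI])
  have "\<theta> \<in> hom ?B ?I" using \<theta> by (auto simp: hom_def)
  moreover have gI: "group ?I" using pI by (simp add: finite_p_group_def)
  ultimately interpret i: group_hom ?B ?I \<theta>
    by (intro group_hom.intro group_hom_axioms.intro gB)
  have ker: "kernel ?B ?I \<theta> = {b \<in> B. \<theta> b = \<one>\<^bsub>Q\<^esub>}" by (auto simp: kernel_def)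
  have "(\<lambda>Z. the_elem (\<theta> ` Z)) \<in> iso (?B Mod kernel ?B ?I \<theta>) ?I"
    by (rule i.FactGroup_iso_set) simp
  then have "card (carrier (?B Mod kernel ?B ?I \<theta>)) = card (\<theta> ` B)"
    by (auto simp: iso_def dest: bij_betw_same_card)
  then have "card (rcosets\<^bsub>?B\<^esub> (kernel ?B ?I \<theta>)) = card (\<theta> ` B)"
    by (simp add: FactGroup_def)
  moreover obtain n where "card (\<theta> ` B) = p ^ n" using pI by (auto simp: finite_p_group_def)
  ultimately show ?thesis
    using i.subgroup_kernel unfolding ker finite_p_index_subgroup_def by auto
qed

text \<open>The kernel \<open>D\<close> of \<open>\<theta>\<close> is p-separable in
  \<open>K\<close>. It has only finitely many cosets in \<open>B\<close>, so a single quotient of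
  \<open>K\<close> separates representatives of all the nontrivial ones from \<open>D\<close>. The
  restriction of that quotient to \<open>B\<close> has its kernel inside \<open>D\<close>.\<close>

lemma p_quotient_kernel_le:
  fixes \<theta> :: "'b \<Rightarrow> nat" and K :: "('b, 'd) monoid_scheme"
  assumes p: "Factorial_Ring.prime p" and K: "group K" and B: "subgroup B K"
    and sep: "\<And>D. finite_p_index_subgroup p K B D \<Longrightarrow> p_separable_in p K D"
    and Q: "finite_p_group p Q" and \<theta>: "\<theta> \<in> hom (K\<lparr>carrier := B\<rparr>) Q"
  obtains R \<beta> where "p_quotient p K R \<beta>"
    "\<And>b. b \<in> B \<Longrightarrow> \<beta> b = \<one>\<^bsub>R\<^esub> \<Longrightarrow> \<theta> b = \<one>\<^bsub>Q\<^esub>"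
proof -
  let ?B = "K\<lparr>carrier := B\<rparr>"
  interpret K: group K by fact
  have gB: "group ?B" using K B by (rule group.subgroup_imp_group)
  have gQ: "group Q" using Q by (simp add: finite_p_group_def)
  interpret g: group_hom ?B Q \<theta>
    by (intro group_hom.intro group_hom_axioms.intro gB gQ \<theta>)
  have BK: "B \<subseteq> carrier K" using B by (rule subgroup.subset)
  define D where "D = {b \<in> B. \<theta> b = \<one>\<^bsub>Q\<^esub>}"
  have "p_separable_in p K D"
    unfolding D_def by (intro sep kernel_finite_p_index p K B Q \<theta>)
  then have D: "\<exists>R \<psi>. p_quotient p K R \<psi> \<and> \<psi> y \<notin> \<psi> ` D" if "y \<in> carrier K" "y \<notin> D" for y
    using that by (simp add: p_separable_in_iff)
  \<comment> \<open>\<open>r z\<close> represents the coset of \<open>D\<close> in \<open>B\<close>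
    on which \<open>\<theta>\<close> takes the value \<open>z\<close>; for nontrivial
    \<open>z\<close> it lies outside \<open>D\<close>.\<close>
  define r where "r z = inv_into B \<theta> z" for z
  have r: "r z \<in> B" "\<theta> (r z) = z" if "z \<in> \<theta> ` B" for z
    using that by (auto simp: r_def inv_into_into f_inv_into_f)
  define F where "F = (\<lambda>z. (r z, D)) ` (\<theta> ` B - {\<one>\<^bsub>Q\<^esub>})"
  have "\<theta> ` B \<subseteq> carrier Q" using \<theta> by (auto simp: hom_def)
  then have "finite (\<theta> ` B)"
    using Q by (auto simp: finite_p_group_def intro: finite_subset)
  then have finF: "finite F" unfolding F_def by simp
  have FD: "y \<in> carrier K \<and> M \<subseteq> carrier K \<and> (\<exists>R \<psi>. p_quotient p K R \<psi> \<and> \<psi> y \<notin> \<psi> ` M)"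
    if "(y, M) \<in> F" for y M
  proof -
    obtain z where z: "z \<in> \<theta> ` B" "z \<noteq> \<one>\<^bsub>Q\<^esub>" "y = r z" "M = D" using \<open>(y, M) \<in> F\<close> by (auto simp: F_def)
    then have "y \<in> carrier K" "y \<notin> D" using r BK by (auto simp: D_def)
    then show ?thesis using D z(4) BK by (auto simp: D_def)
  qed
  from p_quotient_separates_finite[OF K p finF FD] obtain R \<beta> where
    \<beta>: "p_quotient p K R \<beta>" "\<forall>(y, M)\<in>F. \<beta> y \<notin> \<beta> ` M" by blast
  interpret b: group_hom K R \<beta> by (rule p_quotient_group_hom[OF K \<beta>(1)])
  have "\<theta> b = \<one>\<^bsub>Q\<^esub>" if b: "b \<in> B" "\<beta> b = \<one>\<^bsub>R\<^esub>" for b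
  proof (rule ccontr)
    assume n: "\<theta> b \<noteq> \<one>\<^bsub>Q\<^esub>"
    define z where "z = \<theta> b"
    have z: "z \<in> \<theta> ` B" "z \<noteq> \<one>\<^bsub>Q\<^esub>" using b n by (auto simp: z_def)
    have bK: "b \<in> carrier K" "r z \<in> carrier K" using b r(1)[OF z(1)] BK by auto
    \<comment> \<open>\<open>b\<close> and \<open>r z\<close> have the same value under
      \<open>\<theta>\<close>, so they differ by an element of \<open>D\<close>. As
      \<open>\<beta>\<close> kills \<open>b\<close>, it sends \<open>?d\<close> and
      \<open>r z\<close> to the same element, against the choice of \<open>\<beta>\<close>.\<close>
    let ?d = "inv\<^bsub>K\<^esub> b \<otimes>\<^bsub>K\<^esub> r z"
    have ib: "inv\<^bsub>?B\<^esub> b = inv\<^bsub>K\<^esub> b" using b(1) by (rule K.m_inv_consistent[OF B])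
    have ibB: "inv\<^bsub>K\<^esub> b \<in> B" using b(1) B by (simp add: subgroup.m_inv_closed)
    have "?d \<in> B" using ibB r(1)[OF z(1)] B by (simp add: subgroup.m_closed)
    moreover have "\<theta> ?d = \<theta> (inv\<^bsub>K\<^esub> b) \<otimes>\<^bsub>Q\<^esub> \<theta> (r z)"
      using g.hom_mult[of "inv\<^bsub>K\<^esub> b" "r z"] ibB r(1)[OF z(1)] by simp
    moreover have "\<theta> (inv\<^bsub>K\<^esub> b) = inv\<^bsub>Q\<^esub> z" using g.hom_inv[of b] b(1) ib by (simp add: z_def)
    moreover have "z \<in> carrier Q" using g.hom_closed[of b] b(1) by (simp add: z_def)
    ultimately have "?d \<in> D" using r(2)[OF z(1)] by (simp add: D_def)
    moreover have "\<beta> ?d = \<beta> (r z)" using b(2) bK by simp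
    ultimately have "\<beta> (r z) \<in> \<beta> ` D" by (metis imageI)
    moreover have "(r z, D) \<in> F" using z by (auto simp: F_def)
    ultimately show False using \<beta>(2) by auto
  qed
  then show thesis using that \<beta>(1) by blast
qed

text \<open>The target is the central product of the given quotient of \<open>H\<close> and a sufficiently fine
quotient of \<open>K\<close>.\<close>
lemma p_quotient_extend:
  fixes H :: "('a, 'c) monoid_scheme" and K :: "('b, 'd) monoid_scheme"
  assumes p: "Factorial_Ring.prime p" and H: "group H" and K: "group K"
    and A: "central_subgroup H A" and B: "central_subgroup K B"
    and \<phi>: "\<phi> \<in> iso (H\<lparr>carrier := A\<rparr>) (K\<lparr>carrier := B\<rparr>)"
    and sep: "\<And>D. finite_p_index_subgroup p K B D \<Longrightarrow> p_separable_in p K D"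
    and \<alpha>: "p_quotient p H Q \<alpha>"
  obtains P :: "(nat \<times> nat) set monoid" and \<alpha>' \<beta>'
  where "finite_p_group p P" "\<alpha>' \<in> hom H P" "\<beta>' \<in> hom K P" "\<And>a. a \<in> A \<Longrightarrow> \<alpha>' a = \<beta>' (\<phi> a)"
    "\<And>x y. x \<in> carrier H \<Longrightarrow> y \<in> carrier H \<Longrightarrow> conj_in P (\<alpha>' x) (\<alpha>' y) \<Longrightarrow> conj_in Q (\<alpha> x) (\<alpha> y)"
proof -
  let ?A = "H\<lparr>carrier := A\<rparr>" and ?B = "K\<lparr>carrier := B\<rparr>"
  note A' = central_subgroupD[OF A] and B' = central_subgroupD[OF B]
  interpret H: group H by fact
  interpret K: group K by fact
  interpret a: group_hom H Q \<alpha> by (rule p_quotient_group_hom[OF H \<alpha>])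
  have gA: "group ?A" by (rule H.subgroup_imp_group[OF A'(1)])
  have \<phi>B: "\<phi> a \<in> B" if "a \<in> A" for a using \<phi> that by (auto simp: iso_def hom_def)
  have \<phi>m: "\<phi> (a \<otimes>\<^bsub>H\<^esub> b) = \<phi> a \<otimes>\<^bsub>K\<^esub> \<phi> b" if "a \<in> A" "b \<in> A" for a b
    using \<phi> that by (auto simp: iso_def hom_def)
  define \<chi> where "\<chi> = inv_into A \<phi>"
  have \<chi>: "\<chi> \<in> iso ?B ?A"
    using group.iso_set_sym[OF gA \<phi>] by (simp add: \<chi>_def)
  have \<chi>\<phi>: "\<chi> (\<phi> a) = a" if "a \<in> A" for a
    using \<phi> that by (auto simp: \<chi>_def iso_def bij_betw_def)
  have \<theta>: "\<alpha> \<circ> \<chi> \<in> hom ?B Q"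
    using \<chi> a.homh A'(2) by (auto simp: iso_def hom_def Pi_iff subset_iff)
  \<comment> \<open>\<open>\<alpha> \<circ> \<chi>\<close> is the given quotient seen on
    \<open>B\<close>. The kernel condition ensures that the identification made below collapses
    nothing in \<open>Q\<close>.\<close>
  obtain R \<beta> where \<beta>: "p_quotient p K R \<beta>" and
    ker: "\<And>b. b \<in> B \<Longrightarrow> \<beta> b = \<one>\<^bsub>R\<^esub> \<Longrightarrow> (\<alpha> \<circ> \<chi>) b = \<one>\<^bsub>Q\<^esub>"
    using p_quotient_kernel_le[OF p K B'(1) sep p_quotientD(5)[OF \<alpha>] \<theta>] by blast
  interpret b: group_hom K R \<beta> by (rule p_quotient_group_hom[OF K \<beta>])
  let ?S = "Q \<times>\<times> R"
  have pS: "finite_p_group p ?S"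
    by (intro finite_p_group_DirProd p_quotientD(5)[OF \<alpha>] p_quotientD(5)[OF \<beta>])
  interpret S: group ?S using pS by (simp add: finite_p_group_def)
  \<comment> \<open>The antidiagonal copy of \<open>A\<close> in the product. Its image
    \<open>N\<close> is central, and factoring it out identifies \<open>\<alpha> a\<close> with
    \<open>\<beta> (\<phi> a)\<close>.\<close>
  define \<nu> where "\<nu> a = (inv\<^bsub>Q\<^esub> \<alpha> a, \<beta> (\<phi> a))" for a
  have AH: "a \<in> carrier H" if "a \<in> A" for a using that A'(2) by blast
  have \<phi>K: "\<phi> a \<in> carrier K" if "a \<in> A" for a using that B'(2) \<phi>B by blast
  have \<alpha>c: "\<alpha> a \<otimes>\<^bsub>Q\<^esub> q = q \<otimes>\<^bsub>Q\<^esub> \<alpha> a" if a: "a \<in> A" and q: "q \<in> carrier Q" for a q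
  proof -
    obtain h where h: "h \<in> carrier H" "q = \<alpha> h" using q p_quotientD(4)[OF \<alpha>, symmetric] by auto
    have "\<alpha> (a \<otimes>\<^bsub>H\<^esub> h) = \<alpha> (h \<otimes>\<^bsub>H\<^esub> a)" by (simp only: A'(3)[OF a h(1)])
    then show ?thesis using h AH[OF a] by simp
  qed
  have \<beta>c: "\<beta> (\<phi> a) \<otimes>\<^bsub>R\<^esub> q = q \<otimes>\<^bsub>R\<^esub> \<beta> (\<phi> a)" if a: "a \<in> A" and q: "q \<in> carrier R" for a q
  proof -
    obtain k where k: "k \<in> carrier K" "q = \<beta> k" using q p_quotientD(4)[OF \<beta>, symmetric] by auto
    have "\<beta> (\<phi> a \<otimes>\<^bsub>K\<^esub> k) = \<beta> (k \<otimes>\<^bsub>K\<^esub> \<phi> a)" using B'(3)[OF \<phi>B[OF a] k(1)] by simp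
    then show ?thesis using k \<phi>K[OF a] by simp
  qed
  have i\<alpha>c: "inv\<^bsub>Q\<^esub> \<alpha> a \<otimes>\<^bsub>Q\<^esub> q = q \<otimes>\<^bsub>Q\<^esub> inv\<^bsub>Q\<^esub> \<alpha> a" if a: "a \<in> A" and q: "q \<in> carrier Q" for a q
  proof -
    have "inv\<^bsub>H\<^esub> a \<in> A" using a A'(1) by (simp add: subgroup.m_inv_closed)
    then show ?thesis using \<alpha>c[of "inv\<^bsub>H\<^esub> a" q] q AH[OF a] by simp
  qed
  have \<nu>hom: "\<nu> \<in> hom ?A ?S"
  proof (rule homI)
    fix x y assume "x \<in> carrier ?A" "y \<in> carrier ?A"
    then have xy: "x \<in> A" "y \<in> A" by auto
    have "inv\<^bsub>Q\<^esub> (\<alpha> x \<otimes>\<^bsub>Q\<^esub> \<alpha> y) = inv\<^bsub>Q\<^esub> \<alpha> x \<otimes>\<^bsub>Q\<^esub> inv\<^bsub>Q\<^esub> \<alpha> y"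
      using xy AH a.H.inv_mult_group i\<alpha>c[of x "inv\<^bsub>Q\<^esub> \<alpha> y"] by simp
    then show "\<nu> (x \<otimes>\<^bsub>?A\<^esub> y) = \<nu> x \<otimes>\<^bsub>?S\<^esub> \<nu> y"
      using xy AH \<phi>K by (simp add: \<nu>_def \<phi>m)
  qed (use AH \<phi>K in \<open>auto simp: \<nu>_def\<close>)
  define N where "N = \<nu> ` A"
  interpret n: group_hom ?A ?S \<nu>
    by (intro group_hom.intro group_hom_axioms.intro gA S.is_group \<nu>hom)
  have N: "subgroup N ?S" using n.img_is_subgroup by (simp add: N_def)
  have "N \<lhd> ?S"
  proof (rule S.normal_invI[OF N])
    fix x h assume x: "x \<in> carrier ?S" and h: "h \<in> N"
    obtain u v where uv: "x = (u, v)" "u \<in> carrier Q" "v \<in> carrier R" using x by auto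
    obtain a where a: "a \<in> A" "h = \<nu> a" using h by (auto simp: N_def)
    have hS: "h \<in> carrier ?S" using h N subgroup.mem_carrier by fastforce
    have "h \<otimes>\<^bsub>?S\<^esub> x = x \<otimes>\<^bsub>?S\<^esub> h"
      using uv a by (simp add: \<nu>_def i\<alpha>c \<beta>c)
    then have "x \<otimes>\<^bsub>?S\<^esub> h \<otimes>\<^bsub>?S\<^esub> inv\<^bsub>?S\<^esub> x = h \<otimes>\<^bsub>?S\<^esub> x \<otimes>\<^bsub>?S\<^esub> inv\<^bsub>?S\<^esub> x" by simp
    also have "\<dots> = h" using x hS by (simp only: S.m_assoc S.r_inv S.inv_closed S.r_one)
    finally show "x \<otimes>\<^bsub>?S\<^esub> h \<otimes>\<^bsub>?S\<^esub> inv\<^bsub>?S\<^esub> x \<in> N" using h by simp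
  qed
  then interpret N: normal N ?S .
  define \<alpha>' where "\<alpha>' h = N #>\<^bsub>?S\<^esub> (\<alpha> h, \<one>\<^bsub>R\<^esub>)" for h
  define \<beta>' where "\<beta>' k = N #>\<^bsub>?S\<^esub> (\<one>\<^bsub>Q\<^esub>, \<beta> k)" for k
  have "(\<lambda>h. (\<alpha> h, \<one>\<^bsub>R\<^esub>)) \<in> hom H ?S" by (auto simp: hom_def)
  from hom_compose[OF this N.r_coset_hom_Mod] have h1: "\<alpha>' \<in> hom H (?S Mod N)"
    by (simp add: \<alpha>'_def[abs_def] o_def)
  have "(\<lambda>k. (\<one>\<^bsub>Q\<^esub>, \<beta> k)) \<in> hom K ?S" by (auto simp: hom_def)
  from hom_compose[OF this N.r_coset_hom_Mod] have h2: "\<beta>' \<in> hom K (?S Mod N)"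
    by (simp add: \<beta>'_def[abs_def] o_def)
  have agree: "\<alpha>' a = \<beta>' (\<phi> a)" if a: "a \<in> A" for a
  proof -
    have nN: "\<nu> a \<in> N" using a by (simp add: N_def)
    have "\<beta>' (\<phi> a) = N #>\<^bsub>?S\<^esub> (\<nu> a \<otimes>\<^bsub>?S\<^esub> (\<alpha> a, \<one>\<^bsub>R\<^esub>))"
      using a AH \<phi>K by (simp add: \<beta>'_def \<nu>_def)
    also have "\<dots> = (N #>\<^bsub>?S\<^esub> \<nu> a) #>\<^bsub>?S\<^esub> (\<alpha> a, \<one>\<^bsub>R\<^esub>)"
      using a AH N.mem_carrier[OF nN] by (intro S.coset_mult_assoc[symmetric] N.subset) auto
    also have "N #>\<^bsub>?S\<^esub> \<nu> a = N" using nN by (rule N.rcos_const[OF S.is_group])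
    finally show ?thesis by (simp add: \<alpha>'_def)
  qed
  have conj: "conj_in Q (\<alpha> x) (\<alpha> y)"
    if xy: "x \<in> carrier H" "y \<in> carrier H" and c: "conj_in (?S Mod N) (\<alpha>' x) (\<alpha>' y)" for x y
  proof -
    interpret M: group "?S Mod N" by (rule N.factorgroup_is_group)
    have "\<alpha>' x \<in> carrier (?S Mod N)" "\<alpha>' y \<in> carrier (?S Mod N)"
      using h1 xy by (auto simp: hom_def)
    then obtain c where "c \<in> carrier (?S Mod N)"
      and c: "c \<otimes>\<^bsub>?S Mod N\<^esub> \<alpha>' y = \<alpha>' x \<otimes>\<^bsub>?S Mod N\<^esub> c"
      using \<open>conj_in _ (\<alpha>' x) (\<alpha>' y)\<close> M.conj_in_iff[of "\<alpha>' x" "\<alpha>' y"] by auto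
    then obtain u v where uv: "u \<in> carrier Q" "v \<in> carrier R" "c = N #>\<^bsub>?S\<^esub> (u, v)"
      by (auto simp: carrier_FactGroup)
    have "N #>\<^bsub>?S\<^esub> ((u, v) \<otimes>\<^bsub>?S\<^esub> (\<alpha> y, \<one>\<^bsub>R\<^esub>)) = N #>\<^bsub>?S\<^esub> ((\<alpha> x, \<one>\<^bsub>R\<^esub>) \<otimes>\<^bsub>?S\<^esub> (u, v))"
      using c uv xy by (simp add: \<alpha>'_def N.rcos_sum)
    then have "(u, v) \<otimes>\<^bsub>?S\<^esub> (\<alpha> y, \<one>\<^bsub>R\<^esub>) \<in> N #>\<^bsub>?S\<^esub> ((\<alpha> x, \<one>\<^bsub>R\<^esub>) \<otimes>\<^bsub>?S\<^esub> (u, v))"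
      using S.rcos_self[OF _ N, of "(u, v) \<otimes>\<^bsub>?S\<^esub> (\<alpha> y, \<one>\<^bsub>R\<^esub>)"] uv xy by simp
    then obtain a where a: "a \<in> A" and
      "(u \<otimes>\<^bsub>Q\<^esub> \<alpha> y, v) = \<nu> a \<otimes>\<^bsub>?S\<^esub> (\<alpha> x \<otimes>\<^bsub>Q\<^esub> u, v)"
      using uv xy by (auto simp: r_coset_def N_def)
    then have e: "u \<otimes>\<^bsub>Q\<^esub> \<alpha> y = inv\<^bsub>Q\<^esub> \<alpha> a \<otimes>\<^bsub>Q\<^esub> (\<alpha> x \<otimes>\<^bsub>Q\<^esub> u)" "v = \<beta> (\<phi> a) \<otimes>\<^bsub>R\<^esub> v"
      by (simp_all add: \<nu>_def)
    \<comment> \<open>The two sides of the conjugacy equation differ by some \<open>\<nu> a\<close>.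
      The second coordinate forces \<open>\<beta>\<close> to kill \<open>\<phi> a\<close>, hence
      \<open>\<alpha>\<close> kills \<open>a\<close>, and the first coordinate becomes a conjugacy
      in \<open>Q\<close> with conjugating element \<open>u\<close>.\<close>
    have "\<beta> (\<phi> a) = \<one>\<^bsub>R\<^esub>"
      using e(2) uv(2) \<phi>K[OF a] b.H.r_cancel_one'[of v "\<beta> (\<phi> a)"] by simp
    then have "\<alpha> a = \<one>\<^bsub>Q\<^esub>" using ker[OF \<phi>B[OF a]] \<chi>\<phi>[OF a] by simp
    then have "u \<otimes>\<^bsub>Q\<^esub> \<alpha> y = \<alpha> x \<otimes>\<^bsub>Q\<^esub> u" using e(1) uv xy by simp
    then show ?thesis using a.H.conj_in_iff[of "\<alpha> x" "\<alpha> y"] uv xy by auto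
  qed
  show thesis
    by (rule that[OF finite_p_group_Mod[OF p pS \<open>N \<lhd> ?S\<close>] h1 h2 agree conj])
qed

text \<open>\<open>A\<close> has index \<open>p ^ 0\<close> in itself, so the hypothesis makes
  \<open>A\<close> itself p-separable: some quotient keeps \<open>h\<close> out of the image of
  \<open>A\<close>. That image is central there, hence normal, and is factored out. The result
  extends to the amalgam by the trivial map on the other factor.\<close>

lemma quotient_killing_central:
  assumes p: "Factorial_Ring.prime p" and H: "group H" and A: "central_subgroup H A"
    and sep: "\<And>C. finite_p_index_subgroup p H A C \<Longrightarrow> p_separable_in p H C"
    and h: "h \<in> carrier H" "h \<notin> A"
  obtains P :: "nat set monoid" and \<alpha>
  where "finite_p_group p P" "\<alpha> \<in> hom H P" "\<alpha> h \<noteq> \<one>\<^bsub>P\<^esub>" "\<And>a. a \<in> A \<Longrightarrow> \<alpha> a = \<one>\<^bsub>P\<^esub>"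
proof -
  interpret H: group H by fact
  note A' = central_subgroupD[OF A]
  let ?A = "H\<lparr>carrier := A\<rparr>"
  interpret A: group ?A by (rule H.subgroup_imp_group[OF A'(1)])
  have sA: "subgroup A ?A" using A.subgroup_self by simp
  have "rcosets\<^bsub>?A\<^esub> A = {A}"
  proof -
    have "A #>\<^bsub>?A\<^esub> a = A" if "a \<in> A" for a
      using that A.coset_join2[OF _ sA, of a] by simp
    moreover have "A \<noteq> {}" using subgroup.one_closed[OF A'(1)] by auto
    ultimately show ?thesis by (auto simp: RCOSETS_def)
  qed
  then have "card (rcosets\<^bsub>?A\<^esub> A) = p ^ 0" by simp
  then have "finite_p_index_subgroup p H A A"
    using sA unfolding finite_p_index_subgroup_def by blast
  from sep[OF this] h obtain Q \<alpha> where Q: "p_quotient p H Q \<alpha>" "\<alpha> h \<notin> \<alpha> ` A"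
    unfolding p_separable_in_iff by auto
  interpret a: group_hom H Q \<alpha> by (rule p_quotient_group_hom[OF H Q(1)])
  define N where "N = \<alpha> ` A"
  have sN: "subgroup N Q" unfolding N_def by (rule a.subgroup_img_is_subgroup[OF A'(1)])
  have "N \<lhd> Q"
  proof (rule a.H.normal_invI[OF sN])
    fix x n assume x: "x \<in> carrier Q" and n: "n \<in> N"
    obtain y where y: "y \<in> carrier H" "x = \<alpha> y" using x p_quotientD(4)[OF Q(1), symmetric] by auto
    obtain a where a: "a \<in> A" "n = \<alpha> a" using n by (auto simp: N_def)
    have aH: "a \<in> carrier H" using a A'(2) by auto
    have "x \<otimes>\<^bsub>Q\<^esub> n \<otimes>\<^bsub>Q\<^esub> inv\<^bsub>Q\<^esub> x = \<alpha> (y \<otimes>\<^bsub>H\<^esub> a \<otimes>\<^bsub>H\<^esub> inv\<^bsub>H\<^esub> y)" using y a(2) aH by simp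
    also have "y \<otimes>\<^bsub>H\<^esub> a \<otimes>\<^bsub>H\<^esub> inv\<^bsub>H\<^esub> y = a \<otimes>\<^bsub>H\<^esub> y \<otimes>\<^bsub>H\<^esub> inv\<^bsub>H\<^esub> y" by (simp only: A'(3)[OF a(1) y(1)])
    also have "\<dots> = a" using y aH by (simp add: H.m_assoc)
    finally show "x \<otimes>\<^bsub>Q\<^esub> n \<otimes>\<^bsub>Q\<^esub> inv\<^bsub>Q\<^esub> x \<in> N" using a n by simp
  qed
  then interpret N: normal N Q .
  define \<beta> where "\<beta> x = N #>\<^bsub>Q\<^esub> \<alpha> x" for x
  have "\<beta> \<in> hom H (Q Mod N)"
    using hom_compose[OF a.homh N.r_coset_hom_Mod] by (simp add: \<beta>_def[abs_def] o_def)
  moreover have "\<beta> h \<noteq> \<one>\<^bsub>Q Mod N\<^esub>"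
  proof
    assume "\<beta> h = \<one>\<^bsub>Q Mod N\<^esub>"
    then have "\<alpha> h \<in> N" using a.H.rcos_self[OF _ sN, of "\<alpha> h"] h(1) by (simp add: \<beta>_def)
    then show False using Q(2) by (simp add: N_def)
  qed
  moreover have "\<beta> a = \<one>\<^bsub>Q Mod N\<^esub>" if "a \<in> A" for a
    using that N.rcos_const[OF a.H.is_group, of "\<alpha> a"] by (simp add: \<beta>_def N_def)
  ultimately show thesis
    using that finite_p_group_Mod[OF p p_quotientD(5)[OF Q(1)] \<open>N \<lhd> Q\<close>] by blast
qed

subsection \<open>Lifting quotients to wreath products\<close>

text \<open>Residues modulo \<open>q\<close> are represented by the integers in
  \<open>{0..<int q}\<close> and functions are extensional, so that equality of pairs is equality in
  the group and the carrier can be counted. \<open>P\<close> acts by right translation of the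
  argument.\<close>

definition cyclic_wreath :: "nat \<Rightarrow> ('a, 'b) monoid_scheme \<Rightarrow> (('a \<Rightarrow> int) \<times> 'a) monoid" where
  "cyclic_wreath q P =
     \<lparr>carrier = (carrier P \<rightarrow>\<^sub>E {0..<int q}) \<times> carrier P,
      monoid.mult = (\<lambda>x y. (\<lambda>t\<in>carrier P. (fst x t + fst y (t \<otimes>\<^bsub>P\<^esub> snd x)) mod int q,
                     snd x \<otimes>\<^bsub>P\<^esub> snd y)),
      one = (\<lambda>t\<in>carrier P. 0, \<one>\<^bsub>P\<^esub>)\<rparr>"

lemma cyclic_wreath_carrier:
  "x \<in> carrier (cyclic_wreath q P) \<longleftrightarrow>
     fst x \<in> carrier P \<rightarrow>\<^sub>E {0..<int q} \<and> snd x \<in> carrier P"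
  by (cases x) (simp add: cyclic_wreath_def)

lemma cyclic_wreath_simps [simp]:
  "fst (x \<otimes>\<^bsub>cyclic_wreath q P\<^esub> y) =
     (\<lambda>t\<in>carrier P. (fst x t + fst y (t \<otimes>\<^bsub>P\<^esub> snd x)) mod int q)"
  "snd (x \<otimes>\<^bsub>cyclic_wreath q P\<^esub> y) = snd x \<otimes>\<^bsub>P\<^esub> snd y"
  "fst \<one>\<^bsub>cyclic_wreath q P\<^esub> = (\<lambda>t\<in>carrier P. 0)"
  "snd \<one>\<^bsub>cyclic_wreath q P\<^esub> = \<one>\<^bsub>P\<^esub>"
  by (simp_all add: cyclic_wreath_def)

lemma cyclic_wreath_group:
  assumes P: "group P" and q: "q > 0"
  shows "group (cyclic_wreath q P)"
proof -
  interpret group P by fact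
  show ?thesis
  proof (rule groupI, goal_cases)
    case (1 x y)
    then show ?case using q by (simp add: cyclic_wreath_carrier)
  next
    case 2
    then show ?case using q by (simp add: cyclic_wreath_carrier)
  next
    case (3 x y z)
    then have c: "snd x \<in> carrier P" "snd y \<in> carrier P" "snd z \<in> carrier P"
      by (simp_all add: cyclic_wreath_carrier)
    show ?case
    proof (rule prod_eqI)
      show "fst (x \<otimes>\<^bsub>cyclic_wreath q P\<^esub> y \<otimes>\<^bsub>cyclic_wreath q P\<^esub> z) =
            fst (x \<otimes>\<^bsub>cyclic_wreath q P\<^esub> (y \<otimes>\<^bsub>cyclic_wreath q P\<^esub> z))"
        using c by (auto simp: m_assoc mod_simps add.assoc intro!: restrict_ext)
    qed (use c in \<open>simp add: m_assoc\<close>)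
  next
    case (4 x)
    then have x: "fst x \<in> carrier P \<rightarrow>\<^sub>E {0..<int q}" "snd x \<in> carrier P"
      by (simp_all add: cyclic_wreath_carrier)
    show ?case
    proof (rule prod_eqI)
      have "fst x t mod int q = fst x t" if "t \<in> carrier P" for t
        using PiE_mem[OF x(1) that] by simp
      then have "(\<lambda>t\<in>carrier P. fst x t mod int q) = restrict (fst x) (carrier P)"
        by (rule restrict_ext)
      also have "\<dots> = fst x" using x(1) by (rule PiE_restrict)
      finally have "(\<lambda>t\<in>carrier P. fst x t mod int q) = fst x" .
      then show "fst (\<one>\<^bsub>cyclic_wreath q P\<^esub> \<otimes>\<^bsub>cyclic_wreath q P\<^esub> x) = fst x"
        by (simp cong: restrict_cong)
    qed (use x in simp)
  next
    case (5 x)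
    \<comment> \<open>The function component is forced: in the product of \<open>y\<close> and
      \<open>x\<close>, the function of \<open>x\<close> is evaluated at \<open>t\<close> translated
      by the inverse of \<open>snd x\<close>.\<close>
    define y where "y = ((\<lambda>t\<in>carrier P. (- fst x (t \<otimes>\<^bsub>P\<^esub> inv\<^bsub>P\<^esub> snd x)) mod int q), inv\<^bsub>P\<^esub> snd x)"
    have sx: "snd x \<in> carrier P" using 5 by (simp add: cyclic_wreath_carrier)
    have "y \<in> carrier (cyclic_wreath q P)"
      using sx q by (simp add: cyclic_wreath_carrier y_def)
    moreover have "y \<otimes>\<^bsub>cyclic_wreath q P\<^esub> x = \<one>\<^bsub>cyclic_wreath q P\<^esub>"
      by (rule prod_eqI) (use sx in \<open>auto simp: y_def mod_simps intro!: restrict_ext\<close>)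
    ultimately show ?case ..
  qed
qed

lemma cyclic_wreath_finite_p_group:
  assumes p: "p > 0" and P: "finite_p_group p P"
  shows "finite_p_group p (cyclic_wreath (p ^ k) P)"
proof -
  have P': "group P" "finite (carrier P)" using P by (auto simp: finite_p_group_def)
  obtain n where n: "card (carrier P) = p ^ n" using P by (auto simp: finite_p_group_def)
  have "finite (carrier (cyclic_wreath (p ^ k) P))"
    using P' by (simp add: cyclic_wreath_def finite_PiE)
  moreover have "card (carrier (cyclic_wreath (p ^ k) P)) = p ^ (k * p ^ n + n)"
    using P' n by (simp add: cyclic_wreath_def card_cartesian_product card_PiE power_add power_mult
        del: of_nat_power)
  ultimately show ?thesis
    using cyclic_wreath_group[OF P'(1), of "p ^ k"] p unfolding finite_p_group_def by auto
qed

section \<open>Words and an abstract description of central amalgams\<close>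

definition word_prod :: "('a, 'b) monoid_scheme \<Rightarrow> 'a list \<Rightarrow> 'a" where
  "word_prod G w = foldr (\<otimes>\<^bsub>G\<^esub>) w \<one>\<^bsub>G\<^esub>"

lemma word_prod_simps [simp]:
  "word_prod G [] = \<one>\<^bsub>G\<^esub>"
  "word_prod G (s # w) = s \<otimes>\<^bsub>G\<^esub> word_prod G w"
  by (simp_all add: word_prod_def)

context group
begin

lemma word_prod_closed [simp]: "set w \<subseteq> carrier G \<Longrightarrow> word_prod G w \<in> carrier G"
  by (induction w) auto

lemma word_prod_append:
  "set v \<subseteq> carrier G \<Longrightarrow> set w \<subseteq> carrier G \<Longrightarrow>
     word_prod G (v @ w) = word_prod G v \<otimes> word_prod G w"
  by (induction v) (auto simp: m_assoc)

lemma word_prod_rev_inv: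
  "set w \<subseteq> carrier G \<Longrightarrow> word_prod G (map (\<lambda>s. inv s) (rev w)) = inv (word_prod G w)"
proof (induction w)
  case (Cons s w)
  then have "word_prod G (map (\<lambda>s. inv s) (rev w) @ [inv s]) = inv (word_prod G w) \<otimes> inv s"
    by (subst word_prod_append) auto
  then show ?case using Cons.prems by (simp add: inv_mult_group)
qed simp

end

text \<open>Both factors are viewed as subgroups of one group. \<open>universal\<close> has a fixed
  target type, because a locale assumption cannot range over types; it fits wreath products over
  quotients carried by natural numbers. Consequences of the universal property for targets of other
  types enter as \<open>separated_H\<close>, \<open>separated_K\<close>, \<open>kill_K\<close> and
  \<open>kill_H\<close>.\<close>

locale central_amalgam = group G for G :: "('a, 'b) monoid_scheme" (structure) +
  fixes p :: nat and H K A :: "'a set"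
  assumes prime_p: "Factorial_Ring.prime p"
    and subgroup_H: "subgroup H G" and subgroup_K: "subgroup K G" and subgroup_A: "subgroup A G"
    and A_sub: "A \<subseteq> H" "A \<subseteq> K"
    and central: "\<And>a g. a \<in> A \<Longrightarrow> g \<in> carrier G \<Longrightarrow> a \<otimes> g = g \<otimes> a"
    and generated: "\<And>g. g \<in> carrier G \<Longrightarrow> \<exists>w. set w \<subseteq> H \<union> K \<and> g = word_prod G w"
    and separated_H: "\<And>x y. x \<in> H \<Longrightarrow> y \<in> H \<Longrightarrow> \<not> conj_in G x y \<Longrightarrow> p_conj_separated p G x y"
    and separated_K: "\<And>x y. x \<in> K \<Longrightarrow> y \<in> K \<Longrightarrow> \<not> conj_in G x y \<Longrightarrow> p_conj_separated p G x y"
    and kill_K: "\<And>x. x \<in> H - K \<Longrightarrow>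
      \<exists>Q \<psi>. p_quotient p G Q \<psi> \<and> \<psi> x \<noteq> \<one>\<^bsub>Q\<^esub> \<and> (\<forall>k\<in>K. \<psi> k = \<one>\<^bsub>Q\<^esub>)"
    and kill_H: "\<And>x. x \<in> K - H \<Longrightarrow>
      \<exists>Q \<psi>. p_quotient p G Q \<psi> \<and> \<psi> x \<noteq> \<one>\<^bsub>Q\<^esub> \<and> (\<forall>h\<in>H. \<psi> h = \<one>\<^bsub>Q\<^esub>)"
    and universal: "\<And>(W :: ((nat \<Rightarrow> int) \<times> nat) monoid) \<alpha> \<beta>. group W \<Longrightarrow>
      \<alpha> \<in> hom (G\<lparr>carrier := H\<rparr>) W \<Longrightarrow> \<beta> \<in> hom (G\<lparr>carrier := K\<rparr>) W \<Longrightarrow>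
      (\<And>a. a \<in> A \<Longrightarrow> \<alpha> a = \<beta> a) \<Longrightarrow>
      \<exists>\<psi>\<in>hom G W. (\<forall>h\<in>H. \<psi> h = \<alpha> h) \<and> (\<forall>k\<in>K. \<psi> k = \<beta> k)"
begin

lemma H_carrier: "H \<subseteq> carrier G" and K_carrier: "K \<subseteq> carrier G" and A_carrier: "A \<subseteq> carrier G"
  using subgroup_H subgroup_K subgroup_A subgroup.subset by auto

lemma syllables_carrier: "set w \<subseteq> H \<union> K \<Longrightarrow> set w \<subseteq> carrier G"
  using H_carrier K_carrier by blast

text \<open>On \<open>K\<close> the function component is the coboundary of the indicator
  \<open>E\<close> of \<open>\<pi>\<close>
  A\<open>, that is, the obvious copy of\<close>P\<open>conjugated by\<close>E\<open>; on\<close>H\<open>it is zero. The two maps agree on\<close>A\<open>because right translation by an element of\<close>\<pi>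
  \<open>A\<close> preserves that subgroup, and so leaves \<open>E\<close> unchanged.\<close>

lemma hom_to_wreath:
  assumes \<pi>: "p_quotient p G P \<pi>" and q: "q > 0"
  obtains \<psi> where "\<psi> \<in> hom G (cyclic_wreath q P)"
    "\<And>g. g \<in> carrier G \<Longrightarrow> snd (\<psi> g) = \<pi> g"
    "\<And>h t. h \<in> H \<Longrightarrow> t \<in> carrier P \<Longrightarrow> fst (\<psi> h) t = 0"
    "\<And>k t. k \<in> K \<Longrightarrow> t \<in> carrier P \<Longrightarrow>
       fst (\<psi> k) t = (of_bool (t \<otimes>\<^bsub>P\<^esub> \<pi> k \<in> \<pi> ` A) - of_bool (t \<in> \<pi> ` A)) mod int q"
proof -
  interpret h: group_hom G P \<pi> by (rule p_quotient_group_hom[OF is_group \<pi>])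
  let ?W = "cyclic_wreath q P"
  have gW: "group ?W" by (rule cyclic_wreath_group[OF p_quotientD(1)[OF \<pi>] q])
  define E :: "nat \<Rightarrow> int" where "E t = of_bool (t \<in> \<pi> ` A)" for t
  define \<alpha> where "\<alpha> h = (\<lambda>t\<in>carrier P. 0 :: int, \<pi> h)" for h
  define \<beta> where "\<beta> k = (\<lambda>t\<in>carrier P. (E (t \<otimes>\<^bsub>P\<^esub> \<pi> k) - E t) mod int q, \<pi> k)" for k
  have HG: "h \<in> carrier G" if "h \<in> H" for h using that H_carrier by blast
  have KG: "k \<in> carrier G" if "k \<in> K" for k using that K_carrier by blast
  have "\<alpha> \<in> hom (G\<lparr>carrier := H\<rparr>) ?W"
    using HG q by (auto simp: hom_def \<alpha>_def cyclic_wreath_def intro!: restrict_ext)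
  moreover have "\<beta> \<in> hom (G\<lparr>carrier := K\<rparr>) ?W"
  proof (rule homI)
    fix x y assume "x \<in> carrier (G\<lparr>carrier := K\<rparr>)" "y \<in> carrier (G\<lparr>carrier := K\<rparr>)"
    then have "\<pi> x \<in> carrier P" "\<pi> y \<in> carrier P" "\<pi> (x \<otimes> y) = \<pi> x \<otimes>\<^bsub>P\<^esub> \<pi> y" using KG by auto
    then show "\<beta> (x \<otimes>\<^bsub>G\<lparr>carrier := K\<rparr>\<^esub> y) = \<beta> x \<otimes>\<^bsub>?W\<^esub> \<beta> y"
      by (auto simp: \<beta>_def cyclic_wreath_def h.H.m_assoc mod_simps intro!: restrict_ext)
  qed (use KG q in \<open>auto simp: \<beta>_def cyclic_wreath_def\<close>)
  moreover have "\<alpha> a = \<beta> a" if a: "a \<in> A" for a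
  proof -
    have aG: "a \<in> carrier G" using a A_carrier by blast
    have "t \<otimes>\<^bsub>P\<^esub> \<pi> a \<in> \<pi> ` A \<longleftrightarrow> t \<in> \<pi> ` A" if t: "t \<in> carrier P" for t
    proof
      assume "t \<in> \<pi> ` A"
      then obtain b where b: "b \<in> A" "t = \<pi> b" by auto
      then have "t \<otimes>\<^bsub>P\<^esub> \<pi> a = \<pi> (b \<otimes> a)" using aG A_carrier by auto
      then show "t \<otimes>\<^bsub>P\<^esub> \<pi> a \<in> \<pi> ` A" using subgroup.m_closed[OF subgroup_A b(1) a] by simp
    next
      assume "t \<otimes>\<^bsub>P\<^esub> \<pi> a \<in> \<pi> ` A"
      then obtain b where b: "b \<in> A" "t \<otimes>\<^bsub>P\<^esub> \<pi> a = \<pi> b" by auto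
      have bG: "b \<in> carrier G" using b(1) A_carrier by blast
      have "t = t \<otimes>\<^bsub>P\<^esub> \<pi> a \<otimes>\<^bsub>P\<^esub> inv\<^bsub>P\<^esub> \<pi> a" using t aG by (simp add: h.H.m_assoc)
      also have "\<dots> = \<pi> (b \<otimes> inv a)" using b(2) bG aG by simp
      finally show "t \<in> \<pi> ` A"
        using subgroup.m_closed[OF subgroup_A b(1) subgroup.m_inv_closed[OF subgroup_A a]] by simp
    qed
    then show ?thesis by (auto simp: \<alpha>_def \<beta>_def E_def intro!: restrict_ext)
  qed
  ultimately obtain \<psi> where \<psi>: "\<psi> \<in> hom G ?W" "\<forall>h\<in>H. \<psi> h = \<alpha> h" "\<forall>k\<in>K. \<psi> k = \<beta> k"
    using universal[OF gW, of \<alpha> \<beta>] by auto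
  have \<psi>m: "\<psi> (x \<otimes> y) = \<psi> x \<otimes>\<^bsub>?W\<^esub> \<psi> y" if "x \<in> carrier G" "y \<in> carrier G" for x y
    using that \<psi>(1) by (auto simp: hom_def)
  \<comment> \<open>Both \<open>snd \<circ> \<psi>\<close> and \<open>\<pi>\<close> are
    multiplicative and agree on syllables, and words exhaust \<open>G\<close> by
    \<open>generated\<close>.\<close>
  have "snd (\<psi> (word_prod G w)) = \<pi> (word_prod G w)" if "set w \<subseteq> H \<union> K" for w
    using that
  proof (induction w)
    case Nil
    have "\<one> \<in> H" using subgroup_H by (rule subgroup.one_closed)
    then show ?case using \<psi>(2) by (simp add: \<alpha>_def)
  next
    case (Cons s w)
    have c: "s \<in> carrier G" "word_prod G w \<in> carrier G"
      using Cons.prems syllables_carrier[of "s # w"] by auto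
    have "snd (\<psi> s) = \<pi> s" using Cons.prems \<psi> by (auto simp: \<alpha>_def \<beta>_def)
    then show ?case using Cons c \<psi>m[OF c] by (simp add: cyclic_wreath_def)
  qed
  then have "snd (\<psi> g) = \<pi> g" if "g \<in> carrier G" for g using generated[OF that] by auto
  moreover have "fst (\<psi> h) t = 0" if "h \<in> H" "t \<in> carrier P" for h t
    using that \<psi>(2) by (simp add: \<alpha>_def)
  moreover have "fst (\<psi> k) t = (of_bool (t \<otimes>\<^bsub>P\<^esub> \<pi> k \<in> \<pi> ` A) - of_bool (t \<in> \<pi> ` A)) mod int q"
    if "k \<in> K" "t \<in> carrier P" for k t
    using that \<psi>(3) by (simp add: \<beta>_def E_def)
  ultimately show thesis using that \<psi>(1) by blast
qed

end

text \<open>Packages the homomorphism obtained from \<open>hom_to_wreath\<close>. The modulus stays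
  a parameter: modulus \<open>p\<close> serves to detect a single uncancelled term, a large power of
  \<open>p\<close> to count terms.\<close>

locale wreath_lift = central_amalgam +
  fixes P :: "nat monoid" and \<pi> :: "'a \<Rightarrow> nat" and q :: nat and \<psi> :: "'a \<Rightarrow> (nat \<Rightarrow> int) \<times> nat"
  assumes quot: "p_quotient p G P \<pi>" and q: "q > 0"
    and \<psi>_hom: "\<psi> \<in> hom G (cyclic_wreath q P)"
    and \<psi>_snd: "\<And>g. g \<in> carrier G \<Longrightarrow> snd (\<psi> g) = \<pi> g"
    and \<psi>_H: "\<And>h t. h \<in> H \<Longrightarrow> t \<in> carrier P \<Longrightarrow> fst (\<psi> h) t = 0"
    and \<psi>_K: "\<And>k t. k \<in> K \<Longrightarrow> t \<in> carrier P \<Longrightarrow>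
       fst (\<psi> k) t = (of_bool (t \<otimes>\<^bsub>P\<^esub> \<pi> k \<in> \<pi> ` A) - of_bool (t \<in> \<pi> ` A)) mod int q"
begin

sublocale h: group_hom G P \<pi>
  by (rule p_quotient_group_hom[OF is_group quot])

lemma cocycle:
  assumes "x \<in> carrier G" "y \<in> carrier G" "t \<in> carrier P"
  shows "fst (\<psi> (x \<otimes> y)) t = (fst (\<psi> x) t + fst (\<psi> y) (t \<otimes>\<^bsub>P\<^esub> \<pi> x)) mod int q"
proof -
  have "\<psi> (x \<otimes> y) = \<psi> x \<otimes>\<^bsub>cyclic_wreath q P\<^esub> \<psi> y" using assms \<psi>_hom by (auto simp: hom_def)
  then show ?thesis using assms by (simp add: cyclic_wreath_def \<psi>_snd)
qed

text \<open>Unfolded along \<open>w\<close>, the cocycle receives from a syllable in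
  \<open>K\<close> the indicator of \<open>\<pi>\<close> A\<open>at\<close>t\<open>translated by the
  prefix ending in that syllable, minus the same for the prefix before it; a syllable
  in\<close>H\<open>contributes nothing. If no prefix translates\<close>t\<open>into\<close>\<pi>
  \<open>A\<close>, every term vanishes. Later this is applied to an arbitrary word for
  \<open>y\<close>.\<close>

lemma cocycle_zero:
  assumes "set w \<subseteq> H \<union> K" "t \<in> carrier P"
    and "\<And>a b. w = a @ b \<Longrightarrow> t \<otimes>\<^bsub>P\<^esub> \<pi> (word_prod G a) \<notin> \<pi> ` A"
  shows "fst (\<psi> (word_prod G w)) t = 0"
  using assms
proof (induction w arbitrary: t)
  case Nil
  have "\<one> \<in> H" using subgroup_H by (rule subgroup.one_closed)
  then show ?case using Nil \<psi>_H by simp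
next
  case (Cons s w)
  have c: "s \<in> carrier G" "set w \<subseteq> carrier G" using Cons.prems(1) syllables_carrier[of "s # w"] by auto
  have t: "t \<otimes>\<^bsub>P\<^esub> \<pi> s \<in> carrier P" using c Cons.prems(2) by simp
  have "t \<notin> \<pi> ` A" "t \<otimes>\<^bsub>P\<^esub> \<pi> s \<notin> \<pi> ` A"
    using Cons.prems(3)[of "[]" "s # w"] Cons.prems(3)[of "[s]" w] Cons.prems(2) c by simp_all
  then have "fst (\<psi> s) t = 0" using Cons.prems(1,2) \<psi>_H \<psi>_K by auto
  moreover have "fst (\<psi> (word_prod G w)) (t \<otimes>\<^bsub>P\<^esub> \<pi> s) = 0"
  proof (rule Cons.IH[OF _ t])
    fix a b assume w: "w = a @ b"
    then have "word_prod G a \<in> carrier G" using c by simp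
    then show "t \<otimes>\<^bsub>P\<^esub> \<pi> s \<otimes>\<^bsub>P\<^esub> \<pi> (word_prod G a) \<notin> \<pi> ` A"
      using Cons.prems(3)[of "s # a" b] w c Cons.prems(2) by (simp add: h.H.m_assoc)
  qed (use Cons.prems in simp)
  ultimately show ?case using c Cons.prems(2) by (simp add: cocycle)
qed

end

subsection \<open>Reduced words\<close>

text \<open>No syllable lies in \<open>H \<inter> K\<close>, so membership in \<open>H\<close> alone
  names its factor, and \<open>distinct_adj\<close> on these truth values expresses alternation.
  Concatenation and reversal then reduce to facts about \<open>distinct_adj\<close>.\<close>

definition (in central_amalgam) reduced :: "'a list \<Rightarrow> bool" where
  "reduced w \<longleftrightarrow> set w \<subseteq> (H - K) \<union> (K - H) \<and> distinct_adj (map (\<lambda>s. s \<in> H) w)"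

context central_amalgam
begin

lemma reduced_syllables: "reduced w \<Longrightarrow> set w \<subseteq> H \<union> K" "reduced w \<Longrightarrow> set w \<subseteq> carrier G"
  using H_carrier K_carrier by (auto simp: reduced_def)

lemma reduced_Nil [simp]: "reduced []"
  by (simp add: reduced_def)

lemma reduced_append:
  "reduced (v @ w) \<longleftrightarrow> reduced v \<and> reduced w \<and>
     (v = [] \<or> w = [] \<or> (last v \<in> H) \<noteq> (hd w \<in> H))"
  by (cases v rule: rev_cases; cases w) (auto simp: reduced_def distinct_adj_append_iff)

lemma reduced_Cons:
  "reduced (s # w) \<longleftrightarrow> s \<in> (H - K) \<union> (K - H) \<and> reduced w \<and> (w = [] \<or> (s \<in> H) \<noteq> (hd w \<in> H))"
  by (cases w) (auto simp: reduced_def)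

lemma inv_mem_H_iff: "s \<in> carrier G \<Longrightarrow> inv s \<in> H \<longleftrightarrow> s \<in> H"
  using subgroup.m_inv_closed[OF subgroup_H, of s] subgroup.m_inv_closed[OF subgroup_H, of "inv s"]
  by auto

lemma inv_mem_K_iff: "s \<in> carrier G \<Longrightarrow> inv s \<in> K \<longleftrightarrow> s \<in> K"
  using subgroup.m_inv_closed[OF subgroup_K, of s] subgroup.m_inv_closed[OF subgroup_K, of "inv s"]
  by auto

lemma reduced_rev_inv:
  assumes "reduced w"
  shows "reduced (map (\<lambda>s. inv s) (rev w))"
proof -
  have w: "set w \<subseteq> carrier G" using assms by (rule reduced_syllables)
  have "map (\<lambda>s. s \<in> H) (map (\<lambda>s. inv s) (rev w)) = rev (map (\<lambda>s. s \<in> H) w)"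
    using w by (simp add: rev_map inv_mem_H_iff subset_iff)
  moreover have "set (map (\<lambda>s. inv s) (rev w)) \<subseteq> (H - K) \<union> (K - H)"
    using assms w by (auto simp: reduced_def inv_mem_H_iff inv_mem_K_iff subset_iff)
  ultimately show ?thesis using assms unfolding reduced_def by (simp del: map_map)
qed

lemma p_gt_1: "p > 1"
  using prime_p by (rule prime_gt_1_nat)

text \<open>Evaluating the cocycle at the inverse of the first syllable leaves a single nonzero term, the
one at the first interior prefix.\<close>
lemma reduced_separated_from_A:
  assumes "reduced w" "w \<noteq> []"
  shows "\<exists>Q \<psi>. p_quotient p G Q \<psi> \<and> \<psi> (word_prod G w) \<notin> \<psi> ` A"
  using assms
proof (induction "length w" arbitrary: w rule: less_induct)
  case less
  note w = reduced_syllables[OF less.prems(1)]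
  obtain s v where sv: "w = s # v" using less.prems(2) by (cases w) auto
  have sG: "s \<in> carrier G" and sHK: "s \<in> (H - K) \<union> (K - H)"
    using w less.prems(1) sv by (auto simp: reduced_Cons)
  show ?case
  proof (cases v)
    case Nil
    \<comment> \<open>A single syllable survives when the factor not containing it is killed, and
      that factor contains \<open>A\<close>.\<close>
    obtain Q \<psi> where Q: "p_quotient p G Q \<psi>" "\<psi> s \<noteq> \<one>\<^bsub>Q\<^esub>" "\<forall>a\<in>A. \<psi> a = \<one>\<^bsub>Q\<^esub>"
    proof (cases "s \<in> H")
      case True
      then show thesis using that kill_K[of s] sHK A_sub(2) by fastforce
    next
      case False
      then show thesis using that kill_H[of s] sHK A_sub(1) by fastforce
    qed
    have "\<psi> (word_prod G w) \<notin> \<psi> ` A" using sv Nil sG Q(2,3) by auto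
    with Q(1) show ?thesis by auto
  next
    case (Cons r v')
    have vG: "set v \<subseteq> carrier G" using w sv by simp
    have v'G: "set v' \<subseteq> carrier G" and rG: "r \<in> carrier G" using vG Cons by auto
    \<comment> \<open>\<open>s\<close> and the nonempty prefixes of \<open>v\<close> are products of
      reduced words shorter than \<open>w\<close>, so the induction hypothesis separates each of
      them from \<open>A\<close>.\<close>
    define F where "F = insert (s, A) ((\<lambda>n. (word_prod G (take (Suc n) v), A)) ` {..<length v})"
    have F: "y \<in> carrier G \<and> M \<subseteq> carrier G \<and> (\<exists>Q \<psi>. p_quotient p G Q \<psi> \<and> \<psi> y \<notin> \<psi> ` M)"
      if yM: "(y, M) \<in> F" for y M
    proof -
      have "\<exists>u. reduced u \<and> u \<noteq> [] \<and> length u < length w \<and> y = word_prod G u"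
      proof (cases "y = s")
        case True
        then show ?thesis using sG less.prems(1) sv Cons
          by (intro exI[of _ "[s]"]) (auto simp: reduced_Cons)
      next
        case False
        then obtain n where n: "n < length v" "y = word_prod G (take (Suc n) v)"
          using yM by (auto simp: F_def)
        have "reduced (take (Suc n) v @ drop (Suc n) v)"
          using less.prems(1) sv by (simp add: reduced_Cons)
        then have "reduced (take (Suc n) v)" unfolding reduced_append by blast
        then show ?thesis using n sv by (intro exI[of _ "take (Suc n) v"]) auto
      qed
      then obtain u where u: "reduced u" "u \<noteq> []" "length u < length w" "y = word_prod G u" by auto
      moreover have "M = A" using yM by (auto simp: F_def)
      ultimately show ?thesis
        using less.hyps[OF u(3) u(1) u(2)] reduced_syllables(2)[OF u(1)] A_carrier by simp
    qed
    have "finite F" by (simp add: F_def)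
    from p_quotient_separates_finite[OF is_group prime_p this F] obtain P \<pi> where
      quot: "p_quotient p G P \<pi>" and sep: "\<forall>(y, M)\<in>F. \<pi> y \<notin> \<pi> ` M" by auto
    have sep_s: "\<pi> s \<notin> \<pi> ` A" using sep by (simp add: F_def)
    have sep_v: "\<pi> (word_prod G a) \<notin> \<pi> ` A" if ab: "v = a @ b" "a \<noteq> []" for a b
    proof -
      obtain n where n: "length a = Suc n" using ab(2) by (cases a) auto
      then have "a = take (Suc n) v" "n < length v" using ab(1) by auto
      then have "(word_prod G a, A) \<in> F" by (auto simp: F_def)
      then show ?thesis using sep by auto
    qed
    have p0: "p > 0" using p_gt_1 by simp
    obtain \<psi> where "\<psi> \<in> hom G (cyclic_wreath p P)"
      "\<And>g. g \<in> carrier G \<Longrightarrow> snd (\<psi> g) = \<pi> g"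
      "\<And>h t. h \<in> H \<Longrightarrow> t \<in> carrier P \<Longrightarrow> fst (\<psi> h) t = 0"
      "\<And>k t. k \<in> K \<Longrightarrow> t \<in> carrier P \<Longrightarrow>
         fst (\<psi> k) t = (of_bool (t \<otimes>\<^bsub>P\<^esub> \<pi> k \<in> \<pi> ` A) - of_bool (t \<in> \<pi> ` A)) mod int p"
      using hom_to_wreath[OF quot p0] by auto
    then interpret wreath_lift G p H K A P \<pi> p \<psi>
      using quot p0 by unfold_locales
    have one: "\<one>\<^bsub>P\<^esub> \<in> \<pi> ` A"
      using subgroup.one_closed[OF subgroup_A] h.hom_one by (metis imageI)
    let ?t = "inv\<^bsub>P\<^esub> \<pi> s"
    have t: "?t \<in> carrier P" using sG by simp
    have tA: "?t \<notin> \<pi> ` A"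
    proof
      assume "?t \<in> \<pi> ` A"
      then obtain a where a: "a \<in> A" "?t = \<pi> a" by auto
      then have "inv\<^bsub>P\<^esub> ?t = \<pi> (inv a)" using A_carrier by auto
      moreover have "inv\<^bsub>P\<^esub> ?t = \<pi> s" using sG by simp
      ultimately show False using sep_s subgroup.m_inv_closed[OF subgroup_A a(1)] by simp
    qed
    have rA: "\<pi> r \<notin> \<pi> ` A" using sep_v[of "[r]" v'] Cons rG by simp
    have "fst (\<psi> (word_prod G v')) (\<pi> r) = 0"
    proof (rule cocycle_zero)
      show "set v' \<subseteq> H \<union> K" using w(1) sv Cons by simp
      show "\<pi> r \<in> carrier P" using rG by simp
      fix a b assume ab: "v' = a @ b"
      then have "word_prod G a \<in> carrier G" using v'G by simp
      then show "\<pi> r \<otimes>\<^bsub>P\<^esub> \<pi> (word_prod G a) \<notin> \<pi> ` A"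
        using sep_v[of "r # a" b] ab Cons rG by simp
    qed
    then have v_val: "fst (\<psi> (word_prod G v)) \<one>\<^bsub>P\<^esub> = fst (\<psi> r) \<one>\<^bsub>P\<^esub> mod int p"
      using Cons rG v'G by (simp add: cocycle)
    have "fst (\<psi> (word_prod G w)) ?t = (fst (\<psi> s) ?t + fst (\<psi> r) \<one>\<^bsub>P\<^esub>) mod int p"
      using sv sG vG t v_val by (simp add: cocycle mod_simps)
    also have "\<dots> \<noteq> 0"
    proof (cases "s \<in> H")
      case True
      then have "r \<in> K" "r \<notin> H" using less.prems(1) sv Cons by (auto simp: reduced_Cons)
      then have "fst (\<psi> r) \<one>\<^bsub>P\<^esub> = (-1) mod int p" using \<psi>_K[of r "\<one>\<^bsub>P\<^esub>"] rA one rG by simp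
      moreover have "fst (\<psi> s) ?t = 0" using True t \<psi>_H by simp
      ultimately show ?thesis using p_gt_1 by (simp add: zmod_minus1)
    next
      case False
      then have "r \<in> H" "s \<in> K" using less.prems(1) sv Cons sHK by (auto simp: reduced_Cons)
      then have "fst (\<psi> s) ?t = 1 mod int p" "fst (\<psi> r) \<one>\<^bsub>P\<^esub> = 0"
        using \<psi>_K[of s ?t] \<psi>_H[of r "\<one>\<^bsub>P\<^esub>"] t tA one sG by simp_all
      then show ?thesis using p_gt_1 by simp
    qed
    finally have w_val: "fst (\<psi> (word_prod G w)) ?t \<noteq> 0" .
    have "finite_p_group p (cyclic_wreath p P)"
      using cyclic_wreath_finite_p_group[OF p0 p_quotientD(5)[OF quot], of 1] by simp
    from p_quotient_exists[OF is_group prime_p this \<psi>_hom] obtain Q \<psi>' where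
      Q: "p_quotient p G Q \<psi>'" "\<And>y z. y \<in> carrier G \<Longrightarrow> z \<in> carrier G \<Longrightarrow> \<psi>' y = \<psi>' z \<longleftrightarrow> \<psi> y = \<psi> z"
      by blast
    \<comment> \<open>On \<open>A\<close> the cocycle vanishes, since \<open>A\<close> lies in
      \<open>H\<close>; on \<open>w\<close> it does not vanish at \<open>?t\<close>.\<close>
    have "\<psi>' (word_prod G w) \<notin> \<psi>' ` A"
    proof
      assume "\<psi>' (word_prod G w) \<in> \<psi>' ` A"
      then obtain a where a: "a \<in> A" "\<psi>' (word_prod G w) = \<psi>' a" by auto
      then have "\<psi> (word_prod G w) = \<psi> a" using Q(2)[of "word_prod G w" a] w(2) A_carrier by auto
      then show False using w_val \<psi>_H[of a ?t] a(1) A_sub t by auto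
    qed
    then show ?thesis using Q(1) by auto
  qed
qed

section \<open>Cyclically reduced conjugates and residual separation\<close>

lemma rotate_conj:
  assumes "set a \<subseteq> carrier G" "set b \<subseteq> carrier G"
  shows "conj_in G (word_prod G (a @ b)) (word_prod G (b @ a))"
proof -
  let ?a = "word_prod G a" and ?b = "word_prod G b"
  have ab: "?a \<in> carrier G" "?b \<in> carrier G" using assms by simp_all
  then have "?a \<otimes> (?b \<otimes> ?a) = (?a \<otimes> ?b) \<otimes> ?a" by (simp add: m_assoc)
  then show ?thesis
    using ab assms conj_in_iff[of "?a \<otimes> ?b" "?b \<otimes> ?a"] by (auto simp: word_prod_append)
qed

text \<open>With at least two syllables, each has a neighbour, and a syllable lying in both factors
  would share a factor with it. So the absence of mergeable neighbours keeps syllables out of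
  \<open>H \<inter> K\<close> and also yields alternation.\<close>

lemma reduced_if_no_merge:
  assumes "set w \<subseteq> H \<union> K" "length w \<ge> 2"
    and "\<And>a s t b. w = a @ s # t # b \<Longrightarrow> \<not> (s \<in> H \<and> t \<in> H) \<and> \<not> (s \<in> K \<and> t \<in> K)"
  shows "reduced w"
  using assms
proof (induction w)
  case (Cons s w)
  then obtain t v where w: "w = t # v" by (cases w) auto
  have st: "\<not> (s \<in> H \<and> t \<in> H)" "\<not> (s \<in> K \<and> t \<in> K)" using Cons.prems(3)[of "[]" s t v] w by auto
  have "reduced w"
  proof (cases v)
    case Nil
    then show ?thesis using Cons.prems(1) st w by (auto simp: reduced_def)
  next
    case (Cons r v')
    show ?thesis
    proof (rule Cons.IH)
      fix a s' t' b assume "w = a @ s' # t' # b"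
      then show "\<not> (s' \<in> H \<and> t' \<in> H) \<and> \<not> (s' \<in> K \<and> t' \<in> K)"
        using Cons.prems(3)[of "s # a" s' t' b] by simp
    qed (use Cons.prems w Cons in auto)
  qed
  then show ?case using Cons.prems(1) st w by (auto simp: reduced_Cons)
qed simp

text \<open>Take a shortest word representing a conjugate of \<open>g\<close>. Two adjacent
  syllables in a common factor could be multiplied into one, against minimality; rotation preserves
  length and conjugacy class, so the same holds for the last and the first syllable.\<close>

lemma conj_to_cyclically_reduced:
  assumes g: "g \<in> carrier G"
  obtains g' where "g' \<in> H \<union> K" "conj_in G g g'"
  | w where "reduced w" "w \<noteq> []" "hd w \<in> H" "last w \<in> K" "conj_in G g (word_prod G w)"
proof -
  define R where "R n \<longleftrightarrow> (\<exists>w. set w \<subseteq> H \<union> K \<and> conj_in G g (word_prod G w) \<and> length w = n)" for n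
  obtain w0 where "set w0 \<subseteq> H \<union> K" "g = word_prod G w0" using generated[OF g] by auto
  then have "R (length w0)" using conj_in_refl[OF g] by (auto simp: R_def)
  then have "R (LEAST n. R n)" by (rule LeastI)
  then obtain w where w: "set w \<subseteq> H \<union> K" "conj_in G g (word_prod G w)" "length w = (LEAST n. R n)"
    by (auto simp: R_def)
  have min: "length w \<le> length v" if "set v \<subseteq> H \<union> K" "conj_in G g (word_prod G v)" for v
    using that w(3) by (auto simp: R_def intro!: Least_le)
  \<comment> \<open>Stated for every representing word of minimal length, because it is applied to
    \<open>w\<close> and to its rotation.\<close>
  have no_merge: "\<not> (s \<in> H \<and> t \<in> H) \<and> \<not> (s \<in> K \<and> t \<in> K)"
    if v: "set v \<subseteq> H \<union> K" "conj_in G g (word_prod G v)" "length v = length w" "v = a @ s # t # b"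
    for v a s t b
  proof -
    have c: "set a \<subseteq> carrier G" "s \<in> carrier G" "t \<in> carrier G" "set b \<subseteq> carrier G"
      using syllables_carrier[OF v(1)] v(4) by auto
    have "word_prod G (a @ (s \<otimes> t) # b) = word_prod G v"
      using c v(4) by (simp add: word_prod_append m_assoc)
    then have "s \<otimes> t \<notin> H \<union> K" using min[of "a @ (s \<otimes> t) # b"] v by auto
    then show ?thesis
      using subgroup.m_closed[OF subgroup_H, of s t] subgroup.m_closed[OF subgroup_K, of s t] by auto
  qed
  show thesis
  proof (cases "length w \<ge> 2")
    case False
    have "word_prod G w \<in> H \<union> K"
    proof (cases w)
      case Nil
      then show ?thesis using subgroup.one_closed[OF subgroup_H] by simp
    next
      case (Cons s v)
      then have "v = []" using False by (cases v) auto
      then show ?thesis using Cons w(1) syllables_carrier[OF w(1)] by simp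
    qed
    then show thesis using that(1) w(2) by simp
  next
    case True
    define l where "l = last w"
    define m where "m = butlast w"
    have "w \<noteq> []" using True by auto
    then have wm: "w = m @ [l]" by (simp add: m_def l_def)
    have mne: "m \<noteq> []" using True wm by auto
    have wG: "set w \<subseteq> carrier G" using w(1) by (rule syllables_carrier)
    have rw: "reduced w" using w no_merge[OF w(1,2) refl] by (intro reduced_if_no_merge[OF w(1) True])
    have rot: "conj_in G g (word_prod G (l # m))"
    proof -
      have "conj_in G (word_prod G w) (word_prod G ([l] @ m))"
        unfolding wm by (rule rotate_conj) (use wG wm in auto)
      then show ?thesis using conj_in_trans[OF g _ _ w(2)] wG wm by simp
    qed
    have lm: "set (l # m) \<subseteq> H \<union> K" "length (l # m) = length w" using w(1) wm by auto
    have rl: "reduced (l # m)"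
      using no_merge[OF lm(1) rot lm(2)] True lm by (intro reduced_if_no_merge) auto
    show thesis
    \<comment> \<open>Reducedness of the rotation puts \<open>l\<close> and \<open>hd m\<close> in
      different factors. Either \<open>w\<close> itself starts in \<open>H\<close> and ends in
      \<open>K\<close>, or the rotation does, because \<open>last m\<close> precedes
      \<open>l\<close> in \<open>w\<close>.\<close>
    proof (cases "hd m \<in> H")
      case True
      then have "l \<notin> H" using rl mne by (simp add: reduced_Cons)
      then have "l \<in> K" using lm(1) by auto
      then show thesis using that(2)[OF rw] wm mne True w(2) by simp
    next
      case False
      then have lH: "l \<in> H" using rl mne by (simp add: reduced_Cons)
      then have "last m \<notin> H" using rw mne unfolding wm by (simp add: reduced_append)
      moreover have "last m \<in> H \<union> K" using lm(1) mne by (meson last_in_set list.set_intros(2) subsetD)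
      ultimately show thesis using that(2)[OF rl] lH mne rot by simp
    qed
  qed
qed

text \<open>It suffices to keep the nontrivial element \<open>?z\<close> nontrivial, and this may be
  done for a conjugate of it. A conjugate in a factor is separated from the identity by assumption,
  since only the identity is conjugate to the identity; a cyclically reduced word is even separated
  from \<open>A\<close>.\<close>

lemma residually_p:
  assumes x: "x \<in> carrier G" and y: "y \<in> carrier G" and "x \<noteq> y"
  shows "\<exists>Q \<psi>. p_quotient p G Q \<psi> \<and> \<psi> x \<noteq> \<psi> y"
proof -
  let ?z = "inv x \<otimes> y"
  have z: "?z \<in> carrier G" using x y by simp
  have zn: "?z \<noteq> \<one>"
  proof
    assume "?z = \<one>"
    then have "x \<otimes> ?z = x" using x by simp
    then show False using x y assms(3) by (simp flip: m_assoc)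
  qed
  have "\<exists>Q \<psi>. p_quotient p G Q \<psi> \<and> \<psi> ?z \<noteq> \<one>\<^bsub>Q\<^esub>"
  proof -
    have nc: "\<not> conj_in G g \<one>" if g: "g \<in> carrier G" "conj_in G ?z g" for g
    proof
      assume "conj_in G g \<one>"
      then have "conj_in G ?z \<one>" using conj_in_trans[OF z g(1) one_closed g(2)] by simp
      then obtain c where "c \<in> carrier G" "c \<otimes> \<one> = ?z \<otimes> c"
        using conj_in_iff[OF z one_closed] by auto
      then show False using zn z by (simp add: l_cancel_one')
    qed
    have lift: "\<exists>Q \<psi>. p_quotient p G Q \<psi> \<and> \<psi> ?z \<noteq> \<one>\<^bsub>Q\<^esub>"
      if g: "g \<in> carrier G" "conj_in G ?z g" and Q: "p_quotient p G Q \<psi>" "\<psi> g \<noteq> \<one>\<^bsub>Q\<^esub>" for g Q \<psi>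
    proof -
      interpret h: group_hom G Q \<psi> by (rule p_quotient_group_hom[OF is_group Q(1)])
      have "\<psi> ?z \<noteq> \<one>\<^bsub>Q\<^esub>"
      proof
        assume e: "\<psi> ?z = \<one>\<^bsub>Q\<^esub>"
        obtain c where c: "c \<in> carrier G" "c \<otimes> g = ?z \<otimes> c" using conj_in_iff[OF z g(1)] g(2) by auto
        have "\<psi> c \<otimes>\<^bsub>Q\<^esub> \<psi> g = \<psi> (c \<otimes> g)" using c(1) g(1) by simp
        also have "\<dots> = \<psi> ?z \<otimes>\<^bsub>Q\<^esub> \<psi> c" unfolding c(2) using z c(1) by (rule h.hom_mult)
        also have "\<dots> = \<psi> c" using e c(1) by simp
        finally show False using Q(2) c(1) g(1) by simp
      qed
      then show ?thesis using Q(1) by auto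
    qed
    from z show ?thesis
    proof (cases rule: conj_to_cyclically_reduced)
      case (1 g)
      then have gG: "g \<in> carrier G" using H_carrier K_carrier by auto
      have "\<one> \<in> H" "\<one> \<in> K"
        using subgroup.one_closed[OF subgroup_H] subgroup.one_closed[OF subgroup_K] by auto
      then have "p_conj_separated p G g \<one>"
        using 1 nc[OF gG 1(2)] separated_H[of g \<one>] separated_K[of g \<one>] by auto
      then obtain Q \<psi> where Q: "p_quotient p G Q \<psi>" "\<not> conj_in Q (\<psi> g) (\<psi> \<one>)"
        by (auto simp: p_conj_separated_def)
      interpret h: group_hom G Q \<psi> by (rule p_quotient_group_hom[OF is_group Q(1)])
      have "\<psi> g \<noteq> \<one>\<^bsub>Q\<^esub>" using Q(2) h.H.conj_in_refl[of "\<psi> g"] gG by auto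
      then show ?thesis using lift[OF gG 1(2) Q(1)] by simp
    next
      case (2 w)
      obtain Q \<psi> where Q: "p_quotient p G Q \<psi>" "\<psi> (word_prod G w) \<notin> \<psi> ` A"
        using reduced_separated_from_A[OF 2(1,2)] by auto
      interpret h: group_hom G Q \<psi> by (rule p_quotient_group_hom[OF is_group Q(1)])
      have "\<psi> (word_prod G w) \<noteq> \<one>\<^bsub>Q\<^esub>"
        using Q(2) subgroup.one_closed[OF subgroup_A] h.hom_one by (metis imageI)
      then show ?thesis using lift[OF _ 2(5) Q(1)] reduced_syllables(2)[OF 2(1)] by simp
    qed
  qed
  then obtain Q \<psi> where Q: "p_quotient p G Q \<psi>" "\<psi> ?z \<noteq> \<one>\<^bsub>Q\<^esub>" by auto
  interpret h: group_hom G Q \<psi> by (rule p_quotient_group_hom[OF is_group Q(1)])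
  have "\<psi> x \<noteq> \<psi> y" using Q(2) x y by auto
  then show ?thesis using Q(1) by auto
qed

end

subsection \<open>Separating conjugacy classes\<close>

text \<open>The terms of negative sign sit at the prefixes ending in a syllable from \<open>H\<close>; once these are
excluded the cocycle counts without cancellation.\<close>
lemma (in wreath_lift) cocycle_nonneg:
  assumes "reduced w" "t \<in> carrier P"
    and "\<And>a b. w = a @ b \<Longrightarrow> a \<noteq> [] \<Longrightarrow> last a \<in> H \<Longrightarrow>
           t \<otimes>\<^bsub>P\<^esub> \<pi> (word_prod G a) \<notin> \<pi> ` A"
    and "w \<noteq> [] \<Longrightarrow> hd w \<in> K \<Longrightarrow> t \<notin> \<pi> ` A"
  shows "\<exists>N. 0 \<le> N \<and> N \<le> int (length w) \<and> fst (\<psi> (word_prod G w)) t = N mod int q \<and>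
    (w \<noteq> [] \<longrightarrow> last w \<in> K \<longrightarrow> t \<otimes>\<^bsub>P\<^esub> \<pi> (word_prod G w) \<in> \<pi> ` A \<longrightarrow> 1 \<le> N)"
  using assms
proof (induction w arbitrary: t)
  case Nil
  have "\<one> \<in> H" using subgroup_H by (rule subgroup.one_closed)
  then show ?case using Nil \<psi>_H by (intro exI[of _ 0]) simp
next
  case (Cons s w)
  note wG = reduced_syllables(2)[OF Cons.prems(1)]
  have c: "s \<in> carrier G" "set w \<subseteq> carrier G" and s: "s \<in> (H - K) \<union> (K - H)"
    and rw: "reduced w" and nxt: "w \<noteq> [] \<Longrightarrow> (s \<in> H) \<noteq> (hd w \<in> H)"
    using wG Cons.prems(1) by (auto simp: reduced_Cons)
  let ?t = "t \<otimes>\<^bsub>P\<^esub> \<pi> s"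
  have t: "?t \<in> carrier P" using c Cons.prems(2) by simp
  have pre: "t \<otimes>\<^bsub>P\<^esub> \<pi> (word_prod G (s # a)) = ?t \<otimes>\<^bsub>P\<^esub> \<pi> (word_prod G a)"
    if "set a \<subseteq> carrier G" for a
    using that c Cons.prems(2) by (simp add: h.H.m_assoc)
  have "\<exists>N. 0 \<le> N \<and> N \<le> int (length w) \<and> fst (\<psi> (word_prod G w)) ?t = N mod int q \<and>
    (w \<noteq> [] \<longrightarrow> last w \<in> K \<longrightarrow> ?t \<otimes>\<^bsub>P\<^esub> \<pi> (word_prod G w) \<in> \<pi> ` A \<longrightarrow> 1 \<le> N)"
  proof (rule Cons.IH[OF rw t])
    fix a b assume ab: "w = a @ b" "a \<noteq> []" "last a \<in> H"
    then have "t \<otimes>\<^bsub>P\<^esub> \<pi> (word_prod G (s # a)) \<notin> \<pi> ` A"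
      using Cons.prems(3)[of "s # a" b] by simp
    then show "?t \<otimes>\<^bsub>P\<^esub> \<pi> (word_prod G a) \<notin> \<pi> ` A" using pre[of a] c ab(1) by simp
  next
    \<comment> \<open>If the tail starts in \<open>K\<close>, then \<open>s\<close> lies in
      \<open>H\<close>, and the starting point of the tail is covered by the hypothesis on prefixes
      ending in \<open>H\<close>, applied to \<open>[s]\<close>.\<close>
    assume "w \<noteq> []" "hd w \<in> K"
    then have "hd w \<notin> H" using rw by (cases w) (auto simp: reduced_Cons)
    then have "s \<in> H" using nxt \<open>w \<noteq> []\<close> by simp
    then show "?t \<notin> \<pi> ` A" using Cons.prems(3)[of "[s]" w] c by simp
  qed
  then obtain N where N: "0 \<le> N" "N \<le> int (length w)" "fst (\<psi> (word_prod G w)) ?t = N mod int q"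
    "w \<noteq> [] \<longrightarrow> last w \<in> K \<longrightarrow> ?t \<otimes>\<^bsub>P\<^esub> \<pi> (word_prod G w) \<in> \<pi> ` A \<longrightarrow> 1 \<le> N"
    by auto
  \<comment> \<open>The contribution of \<open>s\<close>. For \<open>s\<close> in \<open>K\<close>
    only the positive term at its end remains, since \<open>t\<close> itself is excluded from
    \<open>\<pi>\<close>
    A\<open>. The sum thus counts the prefixes ending in\<close>K\<open>that translate\<close>t\<open>into\<close>\<pi>
    \<open>A\<close>; the whole word may be one of them, whence the lower bound.\<close>
  define M where "M = (if s \<in> H then 0 else of_bool (?t \<in> \<pi> ` A) :: int)"
  have "fst (\<psi> s) t = M mod int q"
  proof (cases "s \<in> H")
    case True
    then show ?thesis using \<psi>_H Cons.prems(2) by (simp add: M_def)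
  next
    case False
    then have "s \<in> K" using s by simp
    then have "t \<notin> \<pi> ` A" using Cons.prems(4) by simp
    then show ?thesis using \<psi>_K[OF \<open>s \<in> K\<close> Cons.prems(2)] False by (simp add: M_def)
  qed
  then have "fst (\<psi> (word_prod G (s # w))) t = (M + N) mod int q"
    using N(3) c Cons.prems(2) by (simp add: cocycle mod_simps)
  moreover have "0 \<le> M + N" "M + N \<le> int (length (s # w))" using N(1,2) by (auto simp: M_def)
  moreover have "1 \<le> M + N"
    if "last (s # w) \<in> K" "t \<otimes>\<^bsub>P\<^esub> \<pi> (word_prod G (s # w)) \<in> \<pi> ` A"
  proof (cases "w = []")
    case True
    then have "s \<notin> H" using that(1) s by auto
    moreover have "?t \<in> \<pi> ` A" using True that(2) c by simp
    ultimately show ?thesis using N(1) by (simp add: M_def)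
  next
    case False
    then have "1 \<le> N" using that N(4) pre[OF c(2)] by simp
    then show ?thesis by (simp add: M_def)
  qed
  ultimately show ?case by (intro exI[of _ "M + N"]) blast
qed

context central_amalgam
begin

text \<open>Conjugating elements of the wreath product are eliminated by summing the cocycle over the
centralizer of the image of \<open>x\<close>, which is invariant under right translation by that image.\<close>
lemma cyclically_reduced_separated:
  assumes w: "reduced w" "w \<noteq> []" "hd w \<in> H" "last w \<in> K"
    and y: "y \<in> carrier G" and nc: "\<not> conj_in G (word_prod G w) y"
  shows "p_conj_separated p G (word_prod G w) y"
proof -
  let ?x = "word_prod G w"
  note wG = reduced_syllables(2)[OF w(1)]
  have x: "?x \<in> carrier G" using wG by simp
  obtain u where u: "set u \<subseteq> H \<union> K" "y = word_prod G u" using generated[OF y] by auto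
  have uG: "set u \<subseteq> carrier G" using u(1) by (rule syllables_carrier)
  \<comment> \<open>Conjugates of \<open>y\<close> by prefixes of a word for \<open>y\<close>. None
    of them equals \<open>?x\<close>, so residual separation applies to each.\<close>
  define cj where "cj n = inv (word_prod G (take n u)) \<otimes> y \<otimes> word_prod G (take n u)" for n
  \<comment> \<open>With \<open>w\<close> split into \<open>a\<close> and \<open>b\<close>, this is
    the commutator of their products, spelled as a word. It is trivial in a quotient exactly when
    the images of \<open>a\<close> and \<open>b\<close> commute there.\<close>
  define cm where "cm n = word_prod G (map (\<lambda>s. inv s) (rev (take n w)) @
      map (\<lambda>s. inv s) (rev (drop n w)) @ w)" for n
  define F where "F = (\<lambda>n. (cj n, {?x})) ` {..length u} \<union>
      (\<lambda>n. (cm n, {\<one>})) ` {n. n \<le> length w \<and> take n w \<noteq> [] \<and> last (take n w) \<in> H}"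
  have cj_closed: "cj n \<in> carrier G" for n
    using uG y set_take_subset[of n u] unfolding cj_def by (meson inv_closed m_closed subset_trans word_prod_closed)
  have F: "z \<in> carrier G \<and> M \<subseteq> carrier G \<and> (\<exists>Q \<psi>. p_quotient p G Q \<psi> \<and> \<psi> z \<notin> \<psi> ` M)"
    if zM: "(z, M) \<in> F" for z M
  proof -
    consider n where "z = cj n" "M = {?x}"
      | n where "z = cm n" "M = {\<one>}" "take n w \<noteq> []" "last (take n w) \<in> H"
      using zM by (auto simp: F_def)
    then show ?thesis
    proof cases
      case 1
      have "cj n \<noteq> ?x"
      proof
        assume "cj n = ?x"
        then have "conj_in G y ?x"
          unfolding conj_in_def cj_def using uG set_take_subset[of n u]
          by (intro bexI[of _ "word_prod G (take n u)"]) auto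
        then show False using nc conj_in_sym[OF y x] by simp
      qed
      then show ?thesis using 1 residually_p[OF cj_closed x] cj_closed[of n] x by auto
    next
      case 2
      let ?a = "take n w" and ?b = "drop n w"
      have ab: "w = ?a @ ?b" by simp
      have lH: "last w \<notin> H" using w(1,2,4) unfolding reduced_def by (meson DiffD2 UnE last_in_set subsetD DiffD1)
      have b: "?b \<noteq> []"
      proof
        assume "?b = []"
        then have "?a = w" using ab by simp
        then show False using 2(4) lH by simp
      qed
      have r: "reduced ?a" "reduced ?b" "(last ?a \<in> H) \<noteq> (hd ?b \<in> H)"
        using w(1) 2(3) b reduced_append[of ?a ?b] by auto
      have hda: "hd ?a \<in> H" using w(3) 2(3) by (cases w; cases n) auto
      have hdb: "hd ?b \<notin> H" using r(3) 2(4) by simp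
      have lb: "last ?b \<notin> H" using lH b by simp
      have sub: "set ?a \<subseteq> carrier G" "set ?b \<subseteq> carrier G"
        using r(1,2) by (auto dest: reduced_syllables)
      have hd_in: "hd ?a \<in> carrier G" "hd ?b \<in> carrier G" "last ?b \<in> carrier G"
        using sub 2(3) b by (meson hd_in_set last_in_set subsetD)+
      let ?c = "map (\<lambda>s. inv s) (rev ?a) @ map (\<lambda>s. inv s) (rev ?b) @ w"
      \<comment> \<open>\<open>?a\<close> starts and ends in \<open>H\<close>, \<open>?b\<close>
        starts and ends in \<open>K\<close>. The blocks therefore meet in the inverses of
        \<open>hd ?a\<close> and \<open>last ?b\<close>, and in the inverse of \<open>hd ?b\<close>
        and \<open>hd w\<close>, each time in different factors.\<close>
      have rc: "reduced ?c"
        unfolding reduced_append using reduced_rev_inv[OF r(1)] reduced_rev_inv[OF r(2)] w 2(3) b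
          hda hdb lb hd_in
        by (simp add: last_map hd_map last_rev hd_rev inv_mem_H_iff)
      have "?c \<noteq> []" using w(2) by simp
      from reduced_separated_from_A[OF rc this] obtain Q \<psi> where
        Q: "p_quotient p G Q \<psi>" "\<psi> (word_prod G ?c) \<notin> \<psi> ` A" by auto
      have "\<psi> (cm n) \<notin> \<psi> ` {\<one>}"
        using Q(2) subgroup.one_closed[OF subgroup_A] unfolding cm_def by auto
      moreover have "cm n \<in> carrier G"
        unfolding cm_def by (rule word_prod_closed[OF reduced_syllables(2)[OF rc]])
      ultimately show ?thesis using 2(1,2) Q(1) by auto
    qed
  qed
  have "finite F" unfolding F_def by simp
  from p_quotient_separates_finite[OF is_group prime_p this F] obtain P \<pi> where
    quot: "p_quotient p G P \<pi>" and sep: "\<forall>(z, M)\<in>F. \<pi> z \<notin> \<pi> ` M" by auto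
  \<comment> \<open>\<open>k\<close> bounds the total count over the centralizer, and the modulus
    exceeds it, so a positive count stays nonzero modulo \<open>q\<close>.\<close>
  define k where "k = card (carrier P) * length w"
  define q where "q = p ^ k"
  have "k < 2 ^ k" by (rule less_exp)
  also have "\<dots> \<le> q" unfolding q_def using p_gt_1 by (intro power_mono) auto
  finally have kq: "k < q" .
  then have q0: "q > 0" by simp
  obtain \<psi> where "\<psi> \<in> hom G (cyclic_wreath q P)"
    "\<And>g. g \<in> carrier G \<Longrightarrow> snd (\<psi> g) = \<pi> g"
    "\<And>h t. h \<in> H \<Longrightarrow> t \<in> carrier P \<Longrightarrow> fst (\<psi> h) t = 0"
    "\<And>k t. k \<in> K \<Longrightarrow> t \<in> carrier P \<Longrightarrow>
       fst (\<psi> k) t = (of_bool (t \<otimes>\<^bsub>P\<^esub> \<pi> k \<in> \<pi> ` A) - of_bool (t \<in> \<pi> ` A)) mod int q"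
    using hom_to_wreath[OF quot q0] by auto
  then interpret wreath_lift G p H K A P \<pi> q \<psi>
    using quot q0 by unfold_locales
  let ?X = "\<pi> ?x" and ?Y = "\<pi> y" and ?W = "cyclic_wreath q P"
  have XY: "?X \<in> carrier P" "?Y \<in> carrier P" using x y by simp_all
  have A_central: "\<pi> a \<otimes>\<^bsub>P\<^esub> g = g \<otimes>\<^bsub>P\<^esub> \<pi> a" if a: "a \<in> A" and g: "g \<in> carrier P" for a g
  proof -
    obtain g' where g': "g' \<in> carrier G" "g = \<pi> g'" using g p_quotientD(4)[OF quot, symmetric] by auto
    have "\<pi> (a \<otimes> g') = \<pi> (g' \<otimes> a)" by (simp only: central[OF a g'(1)])
    then show ?thesis using g' a A_carrier by auto
  qed
  have gW: "group ?W" by (rule cyclic_wreath_group[OF p_quotientD(1)[OF quot] q0])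
  have pW: "finite_p_group p ?W"
    unfolding q_def using p_gt_1 by (intro cyclic_wreath_finite_p_group p_quotientD(5)[OF quot]) simp
  have "\<not> conj_in ?W (\<psi> ?x) (\<psi> y)"
  proof
    assume c: "conj_in ?W (\<psi> ?x) (\<psi> y)"
    have "\<psi> ?x \<in> carrier ?W" "\<psi> y \<in> carrier ?W" using \<psi>_hom x y by (auto simp: hom_def)
    then obtain c where c: "c \<in> carrier ?W" "c \<otimes>\<^bsub>?W\<^esub> \<psi> y = \<psi> ?x \<otimes>\<^bsub>?W\<^esub> c"
      using c group.conj_in_iff[OF gW, of "\<psi> ?x" "\<psi> y"] by auto
    define \<mu> where "\<mu> = fst c"
    define g where "g = snd c"
    have g: "g \<in> carrier P" using c(1) by (simp add: g_def cyclic_wreath_carrier)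
    have gc: "g \<otimes>\<^bsub>P\<^esub> ?Y = ?X \<otimes>\<^bsub>P\<^esub> g"
      using arg_cong[OF c(2), of snd] x y by (simp add: g_def \<psi>_snd)
    have mc: "(\<mu> t + fst (\<psi> y) (t \<otimes>\<^bsub>P\<^esub> g)) mod int q = (fst (\<psi> ?x) t + \<mu> (t \<otimes>\<^bsub>P\<^esub> ?X)) mod int q"
      if t: "t \<in> carrier P" for t
      using fun_cong[OF arg_cong[OF c(2), of fst], of t] x y t by (simp add: g_def \<mu>_def \<psi>_snd)
    define Z where "Z = {t \<in> carrier P. t \<otimes>\<^bsub>P\<^esub> ?X = ?X \<otimes>\<^bsub>P\<^esub> t}"
    have ZP: "t \<in> carrier P" if "t \<in> Z" for t using that by (simp add: Z_def)
    have finZ: "finite Z" using p_quotientD(2)[OF quot] by (simp add: Z_def)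
    \<comment> \<open>The translation permutes \<open>Z\<close>, so the unknown function
      \<open>\<mu>\<close> has the same sum on both sides and cancels.\<close>
    have bij: "bij_betw (\<lambda>t. t \<otimes>\<^bsub>P\<^esub> ?X) Z Z"
    proof -
      have "inj_on (\<lambda>t. t \<otimes>\<^bsub>P\<^esub> ?X) Z" using XY by (auto simp: inj_on_def Z_def)
      moreover have "(\<lambda>t. t \<otimes>\<^bsub>P\<^esub> ?X) ` Z \<subseteq> Z" using XY by (auto simp: Z_def h.H.m_assoc)
      ultimately show ?thesis using endo_inj_surj[OF finZ] by (simp add: bij_betw_def)
    qed
    have "(\<Sum>t\<in>Z. \<mu> t + fst (\<psi> y) (t \<otimes>\<^bsub>P\<^esub> g)) mod int q
        = (\<Sum>t\<in>Z. (\<mu> t + fst (\<psi> y) (t \<otimes>\<^bsub>P\<^esub> g)) mod int q) mod int q" by (simp add: mod_sum_eq)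
    also have "\<dots> = (\<Sum>t\<in>Z. (fst (\<psi> ?x) t + \<mu> (t \<otimes>\<^bsub>P\<^esub> ?X)) mod int q) mod int q"
      using mc ZP by simp
    also have "\<dots> = (\<Sum>t\<in>Z. fst (\<psi> ?x) t + \<mu> (t \<otimes>\<^bsub>P\<^esub> ?X)) mod int q" by (simp add: mod_sum_eq)
    finally have "(\<Sum>t\<in>Z. \<mu> t + fst (\<psi> y) (t \<otimes>\<^bsub>P\<^esub> g)) mod int q
        = (\<Sum>t\<in>Z. fst (\<psi> ?x) t + \<mu> (t \<otimes>\<^bsub>P\<^esub> ?X)) mod int q" .
    moreover have "(\<Sum>t\<in>Z. \<mu> (t \<otimes>\<^bsub>P\<^esub> ?X)) = (\<Sum>t\<in>Z. \<mu> t)"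
      by (rule sum.reindex_bij_betw[OF bij])
    ultimately have "((\<Sum>t\<in>Z. \<mu> t) + (\<Sum>t\<in>Z. fst (\<psi> y) (t \<otimes>\<^bsub>P\<^esub> g))) mod int q
        = ((\<Sum>t\<in>Z. \<mu> t) + (\<Sum>t\<in>Z. fst (\<psi> ?x) t)) mod int q"
      by (simp add: sum.distrib add.commute)
    then have sums: "(\<Sum>t\<in>Z. fst (\<psi> y) (t \<otimes>\<^bsub>P\<^esub> g)) mod int q = (\<Sum>t\<in>Z. fst (\<psi> ?x) t) mod int q"
      by (metis add_diff_cancel_left' mod_diff_left_eq mod_diff_right_eq)
    \<comment> \<open>If \<open>t\<close> translated by \<open>a\<close> were the image of some
      \<open>z\<close> in \<open>A\<close>, then, as both \<open>t\<close> and this central image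
      commute with \<open>?X\<close>, so would the image of \<open>a\<close>. It would then commute
      with the image of the remaining factor \<open>b\<close>, and the commutator
      \<open>cm (length a)\<close> would become trivial.\<close>
    have no_H: "t \<otimes>\<^bsub>P\<^esub> \<pi> (word_prod G a) \<notin> \<pi> ` A"
      if t: "t \<in> Z" and ab: "w = a @ b" "a \<noteq> []" "last a \<in> H" for t a b
    proof
      assume "t \<otimes>\<^bsub>P\<^esub> \<pi> (word_prod G a) \<in> \<pi> ` A"
      then obtain z where z: "z \<in> A" "t \<otimes>\<^bsub>P\<^esub> \<pi> (word_prod G a) = \<pi> z" by auto
      let ?a = "word_prod G a" and ?b = "word_prod G b"
      have G: "?a \<in> carrier G" "?b \<in> carrier G" using wG ab(1) by auto
      have PP: "\<pi> ?a \<in> carrier P" "\<pi> ?b \<in> carrier P" using G by auto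
      have tP: "t \<in> carrier P" "t \<otimes>\<^bsub>P\<^esub> ?X = ?X \<otimes>\<^bsub>P\<^esub> t" using t by (auto simp: Z_def)
      have "t \<otimes>\<^bsub>P\<^esub> (\<pi> ?a \<otimes>\<^bsub>P\<^esub> ?X) = \<pi> z \<otimes>\<^bsub>P\<^esub> ?X"
        using z(2) tP PP XY by (simp flip: h.H.m_assoc)
      also have "\<dots> = ?X \<otimes>\<^bsub>P\<^esub> (t \<otimes>\<^bsub>P\<^esub> \<pi> ?a)" using A_central[OF z(1) XY(1)] z(2) by simp
      also have "\<dots> = t \<otimes>\<^bsub>P\<^esub> (?X \<otimes>\<^bsub>P\<^esub> \<pi> ?a)" using tP PP XY by (simp flip: h.H.m_assoc)
      finally have "\<pi> ?a \<otimes>\<^bsub>P\<^esub> ?X = ?X \<otimes>\<^bsub>P\<^esub> \<pi> ?a" using tP PP XY by simp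
      moreover have X: "?X = \<pi> ?a \<otimes>\<^bsub>P\<^esub> \<pi> ?b" using ab(1) wG G by (simp add: word_prod_append)
      ultimately have ab_comm: "\<pi> ?a \<otimes>\<^bsub>P\<^esub> \<pi> ?b = \<pi> ?b \<otimes>\<^bsub>P\<^esub> \<pi> ?a"
        using PP by (simp add: h.H.m_assoc)
      have ta: "take (length a) w = a" "drop (length a) w = b" using ab(1) by simp_all
      have sub: "set a \<subseteq> carrier G" "set b \<subseteq> carrier G" using wG ab(1) by auto
      have inv_sub: "set (map (\<lambda>s. inv s) (rev v)) \<subseteq> carrier G" if "set v \<subseteq> carrier G" for v
        using that by auto
      have "cm (length a) = inv ?a \<otimes> (inv ?b \<otimes> (?a \<otimes> ?b))"
        unfolding cm_def ta ab(1) using sub inv_sub[of a] inv_sub[of b]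
        by (simp add: word_prod_append word_prod_rev_inv)
      then have "\<pi> (cm (length a)) = inv\<^bsub>P\<^esub> \<pi> ?a \<otimes>\<^bsub>P\<^esub> (inv\<^bsub>P\<^esub> \<pi> ?b \<otimes>\<^bsub>P\<^esub> (\<pi> ?b \<otimes>\<^bsub>P\<^esub> \<pi> ?a))"
        using G ab_comm by simp
      also have "\<dots> = \<one>\<^bsub>P\<^esub>" using PP by (simp flip: h.H.m_assoc)
      finally have "\<pi> (cm (length a)) = \<pi> \<one>" by simp
      moreover have "(cm (length a), {\<one>}) \<in> F" using ab ta by (auto simp: F_def)
      ultimately show False using sep by auto
    qed
    have "\<exists>N. 0 \<le> N \<and> N \<le> int (length w) \<and> fst (\<psi> ?x) t = N mod int q \<and>
        (t \<otimes>\<^bsub>P\<^esub> ?X \<in> \<pi> ` A \<longrightarrow> 1 \<le> N)" if t: "t \<in> Z" for t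
    proof -
      \<comment> \<open>Hence the condition of \<open>cocycle_nonneg\<close> on words starting in
        \<open>K\<close> holds vacuously.\<close>
      have "hd w \<notin> K" using w(1,2,3) by (cases w) (auto simp: reduced_def)
      then show ?thesis
        using cocycle_nonneg[OF w(1) ZP[OF t] no_H[OF t]] w(2,4) by auto
    qed
    then obtain N where N: "\<And>t. t \<in> Z \<Longrightarrow> 0 \<le> N t" "\<And>t. t \<in> Z \<Longrightarrow> N t \<le> int (length w)"
      "\<And>t. t \<in> Z \<Longrightarrow> fst (\<psi> ?x) t = N t mod int q"
      "\<And>t. t \<in> Z \<Longrightarrow> t \<otimes>\<^bsub>P\<^esub> ?X \<in> \<pi> ` A \<Longrightarrow> 1 \<le> N t"
      by metis
    have "(\<Sum>t\<in>Z. N t) \<le> int (card Z) * int (length w)"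
      using sum_bounded_above[of Z N "int (length w)"] N(2) by simp
    also have "\<dots> \<le> int k"
    proof -
      have "card Z \<le> card (carrier P)"
        using p_quotientD(2)[OF quot] by (intro card_mono) (auto simp: Z_def)
      then show ?thesis unfolding k_def by (simp flip: of_nat_mult)
    qed
    finally have N_le: "(\<Sum>t\<in>Z. N t) < int q" using kq by simp
    \<comment> \<open>This point of the centralizer makes the count positive: the whole word, which
      ends in \<open>K\<close>, translates it to the identity.\<close>
    let ?i = "inv\<^bsub>P\<^esub> ?X"
    have "?i \<in> Z" using XY by (simp add: Z_def)
    moreover have "?i \<otimes>\<^bsub>P\<^esub> ?X \<in> \<pi> ` A"
    proof -
      have "?i \<otimes>\<^bsub>P\<^esub> ?X = \<pi> \<one>" using XY by simp
      then show ?thesis using imageI[OF subgroup.one_closed[OF subgroup_A], of \<pi>] by simp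
    qed
    ultimately have "1 \<le> N ?i" using N(4) by simp
    moreover have "N ?i \<le> (\<Sum>t\<in>Z. N t)"
      using \<open>?i \<in> Z\<close> N(1) finZ by (intro member_le_sum) auto
    ultimately have N_ge: "1 \<le> (\<Sum>t\<in>Z. N t)" by simp
    have "(\<Sum>t\<in>Z. fst (\<psi> ?x) t) mod int q = (\<Sum>t\<in>Z. N t mod int q) mod int q" using N(3) by simp
    also have "\<dots> = (\<Sum>t\<in>Z. N t) mod int q" by (simp add: mod_sum_eq)
    also have "\<dots> = (\<Sum>t\<in>Z. N t)" using N_le N_ge by simp
    finally have "(\<Sum>t\<in>Z. fst (\<psi> y) (t \<otimes>\<^bsub>P\<^esub> g)) mod int q \<noteq> 0" using sums N_ge by simp
    then have "(\<Sum>t\<in>Z. fst (\<psi> y) (t \<otimes>\<^bsub>P\<^esub> g)) \<noteq> 0" by (metis mod_0)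
    then obtain t where t: "t \<in> Z" "fst (\<psi> y) (t \<otimes>\<^bsub>P\<^esub> g) \<noteq> 0"
      by (rule sum.not_neutral_contains_not_neutral)
    have tP: "t \<in> carrier P" "t \<otimes>\<^bsub>P\<^esub> ?X = ?X \<otimes>\<^bsub>P\<^esub> t" using t by (auto simp: Z_def)
    then have tg: "t \<otimes>\<^bsub>P\<^esub> g \<in> carrier P" using g by simp
    obtain a b where ab: "u = a @ b" "t \<otimes>\<^bsub>P\<^esub> g \<otimes>\<^bsub>P\<^esub> \<pi> (word_prod G a) \<in> \<pi> ` A"
      using cocycle_zero[OF u(1) tg] t(2) u(2) by auto
    let ?V = "\<pi> (word_prod G a)"
    have vG: "word_prod G a \<in> carrier G" using uG ab(1) by simp
    then have V: "?V \<in> carrier P" by simp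
    \<comment> \<open>Centrality of the image of \<open>z\<close> lets \<open>?X\<close> pass across
      the product of \<open>t\<close>, \<open>g\<close> and \<open>?V\<close>. Together with
      \<open>gc\<close> and the choice of \<open>t\<close> in the centralizer this gives
      \<open>YV\<close>: the prefix conjugates \<open>?Y\<close> to \<open>?X\<close>, which
      \<open>cj\<close> was chosen to exclude.\<close>
    obtain z where z: "z \<in> A" "t \<otimes>\<^bsub>P\<^esub> g \<otimes>\<^bsub>P\<^esub> ?V = \<pi> z" using ab(2) by auto
    have "(t \<otimes>\<^bsub>P\<^esub> g) \<otimes>\<^bsub>P\<^esub> (?Y \<otimes>\<^bsub>P\<^esub> ?V) = t \<otimes>\<^bsub>P\<^esub> (g \<otimes>\<^bsub>P\<^esub> ?Y) \<otimes>\<^bsub>P\<^esub> ?V"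
      using tP g V XY by (simp add: h.H.m_assoc)
    also have "\<dots> = (t \<otimes>\<^bsub>P\<^esub> ?X) \<otimes>\<^bsub>P\<^esub> g \<otimes>\<^bsub>P\<^esub> ?V" unfolding gc using tP(1) g V XY by (simp add: h.H.m_assoc)
    also have "\<dots> = ?X \<otimes>\<^bsub>P\<^esub> (t \<otimes>\<^bsub>P\<^esub> g \<otimes>\<^bsub>P\<^esub> ?V)" unfolding tP(2) using tP(1) g V XY by (simp add: h.H.m_assoc)
    also have "\<dots> = (t \<otimes>\<^bsub>P\<^esub> g \<otimes>\<^bsub>P\<^esub> ?V) \<otimes>\<^bsub>P\<^esub> ?X" unfolding z(2) using A_central[OF z(1) XY(1)] by simp
    also have "\<dots> = (t \<otimes>\<^bsub>P\<^esub> g) \<otimes>\<^bsub>P\<^esub> (?V \<otimes>\<^bsub>P\<^esub> ?X)" using tg V XY by (simp add: h.H.m_assoc)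
    finally have YV: "?Y \<otimes>\<^bsub>P\<^esub> ?V = ?V \<otimes>\<^bsub>P\<^esub> ?X" using tg V XY by simp
    have "\<pi> (cj (length a)) = inv\<^bsub>P\<^esub> ?V \<otimes>\<^bsub>P\<^esub> (?Y \<otimes>\<^bsub>P\<^esub> ?V)"
      unfolding cj_def using ab(1) vG y V XY by (simp add: h.H.m_assoc)
    also have "\<dots> = ?X" unfolding YV using V XY by (simp flip: h.H.m_assoc)
    finally have "\<pi> (cj (length a)) = ?X" .
    moreover have "(cj (length a), {?x}) \<in> F" using ab(1) by (auto simp: F_def)
    ultimately show False using sep by auto
  qed
  then show ?thesis using p_conj_separatedI[OF is_group prime_p pW \<psi>_hom x y] by simp
qed

text \<open>If either element has a cyclically reduced conjugate of length at least two, the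
  preceding lemma applies, by symmetry if necessary. Otherwise both have conjugates in the
  factors.\<close>

theorem conj_p_separable: "conj_p_separable p G"
proof -
  have "p_conj_separated p G x y"
    if x: "x \<in> carrier G" and y: "y \<in> carrier G" and nc: "\<not> conj_in G x y" for x y
  proof -
    have nc': "\<not> conj_in G x' y'"
      if "x' \<in> carrier G" "y' \<in> carrier G" "conj_in G x x'" "conj_in G y y'" for x' y'
      using that x y nc conj_in_trans[of x x' y'] conj_in_trans[of x y' y] conj_in_sym[of y y'] by auto
    note cong = p_conj_separated_cong[OF is_group x y]
    have HKG: "g \<in> carrier G" if "g \<in> H \<union> K" for g using that H_carrier K_carrier by auto
    \<comment> \<open>Killing \<open>K\<close> sends \<open>b\<close> to the identity but not
      \<open>a\<close>, and the identity is conjugate only to itself.\<close>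
    have mixed: "p_conj_separated p G a b" if a: "a \<in> H - K" and b: "b \<in> K - H" for a b
    proof -
      obtain Q \<psi> where Q: "p_quotient p G Q \<psi>" "\<psi> a \<noteq> \<one>\<^bsub>Q\<^esub>" "\<forall>k\<in>K. \<psi> k = \<one>\<^bsub>Q\<^esub>"
        using kill_K[OF a] by auto
      interpret h: group_hom G Q \<psi> by (rule p_quotient_group_hom[OF is_group Q(1)])
      have "\<psi> a \<in> carrier Q" "\<psi> b = \<one>\<^bsub>Q\<^esub>" using a b Q(3) HKG by auto
      then have "\<not> conj_in Q (\<psi> a) (\<psi> b)"
        using Q(2) h.H.conj_in_iff[of "\<psi> a" "\<one>\<^bsub>Q\<^esub>"] by auto
      then show ?thesis using Q(1) by (auto simp: p_conj_separated_def)
    qed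
    show ?thesis
    proof (cases rule: conj_to_cyclically_reduced[OF x])
      case (2 w)
      have "word_prod G w \<in> carrier G" using reduced_syllables(2)[OF 2(1)] by simp
      then show ?thesis
        using cyclically_reduced_separated[OF 2(1-4) y] nc'[of _ y] cong[of _ y] 2(5) y conj_in_refl
        by auto
    next
      case x': (1 x')
      then have x'G: "x' \<in> carrier G" by (intro HKG)
      show ?thesis
      proof (cases rule: conj_to_cyclically_reduced[OF y])
        case (2 w)
        have wG: "word_prod G w \<in> carrier G" using reduced_syllables(2)[OF 2(1)] by simp
        have "\<not> conj_in G (word_prod G w) x"
          using nc'[OF x wG conj_in_refl[OF x] 2(5)] conj_in_sym[OF wG x] by auto
        then have "p_conj_separated p G x (word_prod G w)"
          using cyclically_reduced_separated[OF 2(1-4) x] p_conj_separated_sym[OF is_group wG x] by simp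
        then show ?thesis using cong[OF x wG conj_in_refl[OF x] 2(5)] by simp
      next
        case y': (1 y')
        then have y'G: "y' \<in> carrier G" by (intro HKG)
        have n: "\<not> conj_in G x' y'" by (rule nc'[OF x'G y'G x'(2) y'(2)])
        consider "x' \<in> H \<and> y' \<in> H" | "x' \<in> K \<and> y' \<in> K" | "x' \<in> H - K \<and> y' \<in> K - H"
          | "x' \<in> K - H \<and> y' \<in> H - K"
          using x'(1) y'(1) by auto
        then have "p_conj_separated p G x' y'"
        proof cases
          case 1
          then show ?thesis using separated_H n by simp
        next
          case 2
          then show ?thesis using separated_K n by simp
        next
          case 3
          then show ?thesis using mixed by simp
        next
          case 4
          then show ?thesis using mixed p_conj_separated_sym[OF is_group y'G x'G] by simp
        qed
        then show ?thesis by (rule cong[OF x'G y'G x'(2) y'(2)])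
      qed
    qed
  qed
  then show ?thesis by (simp add: conj_p_separable_iff is_group)
qed

end

subsection \<open>The amalgamated product\<close>

locale amalgam = H: group H + K: group K
  for H :: "('a, 'c) monoid_scheme" and K :: "('b, 'd) monoid_scheme" +
  fixes A :: "'a set" and \<phi> :: "'a \<Rightarrow> 'b"
  assumes A_carrier: "A \<subseteq> carrier H" and \<phi>_carrier: "\<phi> ` A \<subseteq> carrier K"
begin

abbreviation "words \<equiv> amal_words H K"
abbreviation "weq \<equiv> amal_eq H K A \<phi>"
abbreviation "cls \<equiv> amal_class H K A \<phi>"
abbreviation "prd \<equiv> amal_prod H K A \<phi>"

section \<open>The congruence on words and the group of its classes\<close>

lemma words_append [simp]: "u @ v \<in> words \<longleftrightarrow> u \<in> words \<and> v \<in> words"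
  by (auto simp: amal_words_def)

lemma words_simps [simp]:
  "[] \<in> words"
  "Inl h # w \<in> words \<longleftrightarrow> h \<in> carrier H \<and> w \<in> words"
  "Inr k # w \<in> words \<longleftrightarrow> k \<in> carrier K \<and> w \<in> words"
  by (auto simp: amal_words_def)

lemma amal_basic_words: "amal_basic H K A \<phi> l r \<Longrightarrow> l \<in> words \<and> r \<in> words"
  by (induction rule: amal_basic.induct) (use A_carrier \<phi>_carrier in auto)

lemma amal_step_words: "amal_step H K A \<phi> u v \<Longrightarrow> u \<in> words \<and> v \<in> words"
  unfolding amal_step_def by (auto dest: amal_basic_words)

lemma weq_refl [simp]: "weq w w"
  by (simp add: amal_eq_def)

lemma weq_sym: "weq u v \<Longrightarrow> weq v u"
  unfolding amal_eq_def by (rule equivclp_sym)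

lemma weq_trans: "weq u v \<Longrightarrow> weq v w \<Longrightarrow> weq u w"
  unfolding amal_eq_def by (rule equivclp_trans)

lemma weq_basic:
  assumes "amal_basic H K A \<phi> l r"
  shows "weq l r"
proof -
  have "amal_step H K A \<phi> l r" unfolding amal_step_def
    using assms by (intro exI[of _ "[]"] exI[of _ l] exI[of _ r]) simp
  then show ?thesis unfolding amal_eq_def by (rule r_into_equivclp)
qed

lemma weq_induct [consumes 1, case_names refl step]:
  assumes "weq u v"
    and "P u"
    and "\<And>v w. weq u v \<Longrightarrow> amal_step H K A \<phi> v w \<or> amal_step H K A \<phi> w v \<Longrightarrow> P v \<Longrightarrow> P w"
  shows "P v"
  using assms unfolding amal_eq_def by (rule equivclp_induct)

lemma weq_words: "weq u v \<Longrightarrow> u \<in> words \<Longrightarrow> v \<in> words"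
  by (induction rule: weq_induct) (auto dest: amal_step_words)

lemma amal_step_context:
  assumes "amal_step H K A \<phi> u v" "x \<in> words" "y \<in> words"
  shows "amal_step H K A \<phi> (x @ u @ y) (x @ v @ y)"
proof -
  obtain a b l r where "a \<in> words" "b \<in> words" "amal_basic H K A \<phi> l r" "u = a @ l @ b" "v = a @ r @ b"
    using assms(1) by (auto simp: amal_step_def)
  then show ?thesis unfolding amal_step_def using assms(2,3)
    by (intro exI[of _ "x @ a"] exI[of _ "b @ y"] exI[of _ l] exI[of _ r]) simp
qed

lemma weq_context:
  assumes "weq u v" "x \<in> words" "y \<in> words"
  shows "weq (x @ u @ y) (x @ v @ y)"
  using assms(1)
proof (induction rule: weq_induct)
  case (step v w)
  then have "weq (x @ v @ y) (x @ w @ y)"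
    using amal_step_context[OF _ assms(2,3)] unfolding amal_eq_def
    by (auto intro: r_into_equivclp converse_r_into_equivclp)
  then show ?case using step.IH weq_trans by blast
qed simp

lemma weq_append:
  assumes "weq u u'" "weq v v'" "u \<in> words" "v \<in> words"
  shows "weq (u @ v) (u' @ v')"
proof -
  have "weq (u @ v) (u' @ v)" using weq_context[OF assms(1), of "[]" v] assms(4) by simp
  moreover have "weq (u' @ v) (u' @ v')"
    using weq_context[OF assms(2), of u' "[]"] weq_words[OF assms(1,3)] by simp
  ultimately show ?thesis by (rule weq_trans)
qed

lemma cls_eq_iff: "cls u = cls v \<longleftrightarrow> weq u v"
proof
  assume "cls u = cls v"
  moreover have "v \<in> cls v" by (simp add: amal_class_def)
  ultimately have "v \<in> cls u" by simp
  then show "weq u v" by (simp add: amal_class_def)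
next
  assume "weq u v"
  then show "cls u = cls v" unfolding amal_class_def using weq_sym weq_trans by blast
qed

lemma prd_carrier: "carrier prd = cls ` words"
  and prd_one: "\<one>\<^bsub>prd\<^esub> = cls []"
  by (simp_all add: amal_prod_def)

lemma cls_closed [simp]: "w \<in> words \<Longrightarrow> cls w \<in> carrier prd"
  by (simp add: prd_carrier)

text \<open>The product of two classes collects all words equivalent to some concatenation of
  representatives. Since \<open>weq\<close> is a congruence on words, one pair of representatives
  already determines this set.\<close>

lemma cls_mult:
  assumes "u \<in> words" "v \<in> words"
  shows "cls u \<otimes>\<^bsub>prd\<^esub> cls v = cls (u @ v)"
proof -
  have "weq (u' @ v') w \<longleftrightarrow> weq (u @ v) w" if "weq u u'" "weq v v'" for u' v' w
    using weq_append[OF that assms] weq_sym weq_trans by blast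
  moreover have "weq u u" "weq v v" by simp_all
  ultimately show ?thesis
    unfolding amal_prod_def amal_class_def by (simp, blast)
qed

lemma left_inverse_word:
  assumes "w \<in> words"
  shows "\<exists>v\<in>words. weq (v @ w) []"
  using assms
proof (induction w)
  case Nil
  show ?case by (intro bexI[of _ "[]"]) simp_all
next
  case (Cons l w)
  have lw: "[l] \<in> words" "w \<in> words" using Cons.prems by (auto simp: amal_words_def)
  obtain v where v: "v \<in> words" "weq (v @ w) []" using Cons.IH[OF lw(2)] by auto
  have "\<exists>m. [m] \<in> words \<and> weq [m, l] []"
  proof (cases l)
    case (Inl h)
    then have h: "h \<in> carrier H" using lw by simp
    have "weq [Inl (inv\<^bsub>H\<^esub> h), Inl h] [Inl (inv\<^bsub>H\<^esub> h \<otimes>\<^bsub>H\<^esub> h)]"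
      using h by (intro weq_basic amal_basic.mult_H) simp_all
    then have "weq [Inl (inv\<^bsub>H\<^esub> h), Inl h] []"
      using h weq_trans[OF _ weq_basic[OF amal_basic.one_H]] by simp
    then show ?thesis using h Inl by (intro exI[of _ "Inl (inv\<^bsub>H\<^esub> h)"]) simp
  next
    case (Inr k)
    then have k: "k \<in> carrier K" using lw by simp
    have "weq [Inr (inv\<^bsub>K\<^esub> k), Inr k] [Inr (inv\<^bsub>K\<^esub> k \<otimes>\<^bsub>K\<^esub> k)]"
      using k by (intro weq_basic amal_basic.mult_K) simp_all
    then have "weq [Inr (inv\<^bsub>K\<^esub> k), Inr k] []"
      using k weq_trans[OF _ weq_basic[OF amal_basic.one_K]] by simp
    then show ?thesis using k Inr by (intro exI[of _ "Inr (inv\<^bsub>K\<^esub> k)"]) simp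
  qed
  then obtain m where m: "[m] \<in> words" "weq [m, l] []" by auto
  have "weq (v @ [m, l] @ w) (v @ [] @ w)" by (rule weq_context[OF m(2) v(1) lw(2)])
  then have "weq ((v @ [m]) @ l # w) []" using v(2) weq_trans by simp
  then show ?case using v(1) m(1) by (intro bexI[of _ "v @ [m]"]) simp_all
qed

sublocale prd: group prd
proof (rule groupI)
  fix x y assume "x \<in> carrier prd" "y \<in> carrier prd"
  then show "x \<otimes>\<^bsub>prd\<^esub> y \<in> carrier prd" by (auto simp: prd_carrier cls_mult)
next
  fix x y z assume "x \<in> carrier prd" "y \<in> carrier prd" "z \<in> carrier prd"
  then show "x \<otimes>\<^bsub>prd\<^esub> y \<otimes>\<^bsub>prd\<^esub> z = x \<otimes>\<^bsub>prd\<^esub> (y \<otimes>\<^bsub>prd\<^esub> z)" by (auto simp: prd_carrier cls_mult)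
next
  fix x assume "x \<in> carrier prd"
  then obtain w where w: "w \<in> words" "x = cls w" by (auto simp: prd_carrier)
  then obtain v where v: "v \<in> words" "weq (v @ w) []" using left_inverse_word by blast
  then have "cls v \<otimes>\<^bsub>prd\<^esub> x = \<one>\<^bsub>prd\<^esub>" using w by (simp add: cls_mult prd_one cls_eq_iff)
  then show "\<exists>y\<in>carrier prd. y \<otimes>\<^bsub>prd\<^esub> x = \<one>\<^bsub>prd\<^esub>" using v(1) by (intro bexI[of _ "cls v"]) simp_all
qed (auto simp: prd_carrier prd_one cls_mult)

definition inH :: "'a \<Rightarrow> ('a + 'b) list set" where "inH h = cls [Inl h]"
definition inK :: "'b \<Rightarrow> ('a + 'b) list set" where "inK k = cls [Inr k]"

lemma inH_hom: "inH \<in> hom H prd"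
  by (rule homI) (auto simp: inH_def cls_mult cls_eq_iff intro: weq_sym weq_basic amal_basic.mult_H)

lemma inK_hom: "inK \<in> hom K prd"
  by (rule homI) (auto simp: inK_def cls_mult cls_eq_iff intro: weq_sym weq_basic amal_basic.mult_K)

lemma inH_eq_inK: "a \<in> A \<Longrightarrow> inH a = inK (\<phi> a)"
  by (simp add: inH_def inK_def cls_eq_iff weq_basic amal_basic.amalg)

lemma cls_generated:
  assumes "w \<in> words"
  shows "\<exists>v. set v \<subseteq> inH ` carrier H \<union> inK ` carrier K \<and> cls w = word_prod prd v"
  using assms
proof (induction w)
  case Nil
  show ?case by (intro exI[of _ "[]"]) (simp add: prd_one)
next
  case (Cons l w)
  have lw: "[l] \<in> words" "w \<in> words" using Cons.prems by (auto simp: amal_words_def)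
  obtain v where v: "set v \<subseteq> inH ` carrier H \<union> inK ` carrier K" "cls w = word_prod prd v"
    using Cons.IH[OF lw(2)] by auto
  have "cls [l] \<in> inH ` carrier H \<union> inK ` carrier K"
    using lw(1) by (cases l) (auto simp: inH_def inK_def)
  moreover have "cls (l # w) = cls [l] \<otimes>\<^bsub>prd\<^esub> cls w" using cls_mult[OF lw] by simp
  ultimately show ?case using v by (intro exI[of _ "cls [l] # v"]) simp
qed

text \<open>Evaluating a word syllable by syllable in \<open>L\<close> respects every defining
  relation, the amalgamation relations by \<open>agree\<close>, and hence depends only on the class
  of the word.\<close>

lemma lift:
  fixes L :: "('x, 'y) monoid_scheme"
  assumes L: "group L" and \<alpha>: "\<alpha> \<in> hom H L" and \<beta>: "\<beta> \<in> hom K L"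
    and agree: "\<And>a. a \<in> A \<Longrightarrow> \<alpha> a = \<beta> (\<phi> a)"
  shows "\<exists>\<psi>\<in>hom prd L. (\<forall>h\<in>carrier H. \<psi> (inH h) = \<alpha> h) \<and> (\<forall>k\<in>carrier K. \<psi> (inK k) = \<beta> k)"
proof -
  interpret L: group L by fact
  interpret a: group_hom H L \<alpha>
    by (intro group_hom.intro group_hom_axioms.intro \<alpha> H.is_group L)
  interpret b: group_hom K L \<beta>
    by (intro group_hom.intro group_hom_axioms.intro \<beta> K.is_group L)
  define ev where "ev w = word_prod L (map (case_sum \<alpha> \<beta>) w)" for w
  have sub: "set (map (case_sum \<alpha> \<beta>) w) \<subseteq> carrier L" if "w \<in> words" for w
    using that by (auto simp: amal_words_def split: sum.splits)
  have ev_append: "ev (u @ v) = ev u \<otimes>\<^bsub>L\<^esub> ev v" if "u \<in> words" "v \<in> words" for u v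
    using L.word_prod_append[OF sub[OF that(1)] sub[OF that(2)]] by (simp add: ev_def)
  have ev_closed: "ev w \<in> carrier L" if "w \<in> words" for w
    using L.word_prod_closed[OF sub[OF that]] by (simp add: ev_def)
  have "ev l = ev r" if "amal_basic H K A \<phi> l r" for l r
    using that
    by (induction rule: amal_basic.induct) (use agree in \<open>simp_all add: ev_def\<close>)
  then have step: "ev u = ev v" if "amal_step H K A \<phi> u v" for u v
    using that amal_basic_words by (auto simp: amal_step_def ev_append)
  have weq: "ev u = ev v" if "weq u v" for u v
    using that
  proof (induction rule: weq_induct)
    case (step v w)
    then show ?case using \<open>\<And>u v. amal_step H K A \<phi> u v \<Longrightarrow> ev u = ev v\<close> by metis
  qed simp
  \<comment> \<open>The choice of a representative is harmless, because \<open>ev\<close> is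
    constant on classes.\<close>
  define \<psi> where "\<psi> U = ev (SOME w. w \<in> U)" for U
  have \<psi>: "\<psi> (cls w) = ev w" for w
  proof -
    have "w \<in> cls w" by (simp add: amal_class_def)
    then have "(SOME v. v \<in> cls w) \<in> cls w" by (rule someI)
    then show ?thesis using weq by (simp add: \<psi>_def amal_class_def)
  qed
  have "\<psi> \<in> hom prd L"
    by (rule homI) (auto simp: prd_carrier \<psi> cls_mult ev_append ev_closed)
  moreover have "\<psi> (inH h) = \<alpha> h" if "h \<in> carrier H" for h
    using that by (simp add: inH_def \<psi> ev_def)
  moreover have "\<psi> (inK k) = \<beta> k" if "k \<in> carrier K" for k
    using that by (simp add: inK_def \<psi> ev_def)
  ultimately show ?thesis by (intro bexI[of _ \<psi>]) auto
qed

end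

theorem theorem2:
  fixes p :: nat
    and H :: "('a, 'c) monoid_scheme" and K :: "('b, 'd) monoid_scheme"
    and A :: "'a set" and B :: "'b set" and \<phi> :: "'a \<Rightarrow> 'b"
  assumes "Factorial_Ring.prime p"
    and "conj_p_separable p H" and "conj_p_separable p K"
    and "central_subgroup H A" and "central_subgroup K B"
    and "\<phi> \<in> iso (H\<lparr>carrier := A\<rparr>) (K\<lparr>carrier := B\<rparr>)"
    and "\<forall>C. finite_p_index_subgroup p H A C \<longrightarrow> p_separable_in p H C"
    and "\<forall>D. finite_p_index_subgroup p K B D \<longrightarrow> p_separable_in p K D"
  shows "conj_p_separable p (amal_prod H K A \<phi>)"
proof -
  note p = assms(1) and A = assms(4) and B = assms(5) and iso = assms(6)
  note A' = central_subgroupD[OF A] and B' = central_subgroupD[OF B]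
  have sepA: "p_separable_in p H C" if "finite_p_index_subgroup p H A C" for C
    using assms(7) that by simp
  have sepB: "p_separable_in p K D" if "finite_p_index_subgroup p K B D" for D
    using assms(8) that by simp
  have gH: "group H" and gK: "group K"
    and sH: "\<And>x y. x \<in> carrier H \<Longrightarrow> y \<in> carrier H \<Longrightarrow> \<not> conj_in H x y \<Longrightarrow> p_conj_separated p H x y"
    and sK: "\<And>x y. x \<in> carrier K \<Longrightarrow> y \<in> carrier K \<Longrightarrow> \<not> conj_in K x y \<Longrightarrow> p_conj_separated p K x y"
    using assms(2,3) by (simp_all add: conj_p_separable_iff)
  have \<phi>AB: "\<phi> ` A = B" using iso by (auto simp: iso_def bij_betw_def)
  interpret amalgam H K A \<phi>
    by (intro amalgam.intro amalgam_axioms.intro gH gK A'(2)) (use \<phi>AB B'(2) in simp)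
  interpret h: group_hom H prd inH
    by (intro group_hom.intro group_hom_axioms.intro gH inH_hom prd.is_group)
  interpret k: group_hom K prd inK
    by (intro group_hom.intro group_hom_axioms.intro gK inK_hom prd.is_group)
  \<comment> \<open>The inverse isomorphism allows \<open>p_quotient_extend\<close> to be applied
    with the two factors exchanged.\<close>
  define \<chi> where "\<chi> = inv_into A \<phi>"
  have \<chi>: "\<chi> \<in> iso (K\<lparr>carrier := B\<rparr>) (H\<lparr>carrier := A\<rparr>)"
    using group.iso_set_sym[OF H.subgroup_imp_group[OF A'(1)] iso] by (simp add: \<chi>_def)
  have \<chi>\<phi>: "\<chi> (\<phi> a) = a" if "a \<in> A" for a
    using iso that by (auto simp: \<chi>_def iso_def bij_betw_def)
  \<comment> \<open>Turns a homomorphism to a factor group, whose elements are sets, into a quotient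
    carried by natural numbers. Equal fibres preserve which elements become trivial.\<close>
  have kill: "\<exists>Q \<psi>. p_quotient p prd Q \<psi> \<and> \<psi> x \<noteq> \<one>\<^bsub>Q\<^esub> \<and> (\<forall>k\<in>S. \<psi> k = \<one>\<^bsub>Q\<^esub>)"
    if P: "finite_p_group p P" and \<psi>: "\<psi> \<in> hom prd P" and x: "x \<in> carrier prd" "\<psi> x \<noteq> \<one>\<^bsub>P\<^esub>"
      and S: "S \<subseteq> carrier prd" "\<And>s. s \<in> S \<Longrightarrow> \<psi> s = \<one>\<^bsub>P\<^esub>"
    for P :: "nat set monoid" and \<psi> x S
  proof -
    have gP: "group P" using P by (simp add: finite_p_group_def)
    have \<psi>1: "\<psi> \<one>\<^bsub>prd\<^esub> = \<one>\<^bsub>P\<^esub>" by (rule hom_one[OF \<psi> prd.is_group gP])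
    obtain Q \<psi>' where Q: "p_quotient p prd Q \<psi>'" "\<And>y z. y \<in> carrier prd \<Longrightarrow> z \<in> carrier prd \<Longrightarrow>
        \<psi>' y = \<psi>' z \<longleftrightarrow> \<psi> y = \<psi> z"
      using p_quotient_exists[OF prd.is_group p P \<psi>] by blast
    have "\<psi>' \<one>\<^bsub>prd\<^esub> = \<one>\<^bsub>Q\<^esub>" by (rule hom_one[OF p_quotientD(3)[OF Q(1)] prd.is_group p_quotientD(1)[OF Q(1)]])
    then have "\<psi>' y = \<one>\<^bsub>Q\<^esub> \<longleftrightarrow> \<psi> y = \<one>\<^bsub>P\<^esub>" if "y \<in> carrier prd" for y
      using Q(2)[OF that prd.one_closed] \<psi>1 by simp
    then show ?thesis using Q(1) x S by (intro exI[of _ Q] exI[of _ \<psi>']) auto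
  qed
  interpret central_amalgam prd p "inH ` carrier H" "inK ` carrier K" "inH ` A"
  proof (intro central_amalgam.intro central_amalgam_axioms.intro prd.is_group, goal_cases)
    case 1
    show ?case by (rule p)
  next
    case 2
    show ?case by (rule h.img_is_subgroup)
  next
    case 3
    show ?case by (rule k.img_is_subgroup)
  next
    case 4
    show ?case by (rule h.subgroup_img_is_subgroup[OF A'(1)])
  next
    case 5
    show ?case using A'(2) by auto
  next
    case 6
    show ?case using inH_eq_inK \<phi>_carrier by auto
  next
    case (7 c g)
    then obtain a where a: "a \<in> A" "c = inH a" by auto
    have aH: "a \<in> carrier H" using a A'(2) by auto
    have \<phi>a: "\<phi> a \<in> B" "\<phi> a \<in> carrier K" using a \<phi>AB B'(2) by auto
    \<comment> \<open>An element of the amalgamated subgroup commutes with syllables from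
      \<open>H\<close> as the image of \<open>a\<close>, and with those from \<open>K\<close> as the
      image of \<open>\<phi> a\<close>.\<close>
    have syl: "c \<otimes>\<^bsub>prd\<^esub> s = s \<otimes>\<^bsub>prd\<^esub> c" if s: "s \<in> inH ` carrier H \<union> inK ` carrier K" for s
    proof (cases "s \<in> inH ` carrier H")
      case True
      then obtain x where x: "x \<in> carrier H" "s = inH x" by auto
      have "inH (a \<otimes>\<^bsub>H\<^esub> x) = inH (x \<otimes>\<^bsub>H\<^esub> a)" by (simp only: A'(3)[OF a(1) x(1)])
      then show ?thesis using a x aH by simp
    next
      case False
      then obtain x where x: "x \<in> carrier K" "s = inK x" using s by auto
      have "inK (\<phi> a \<otimes>\<^bsub>K\<^esub> x) = inK (x \<otimes>\<^bsub>K\<^esub> \<phi> a)" by (simp only: B'(3)[OF \<phi>a(1) x(1)])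
      then show ?thesis using a x \<phi>a by (simp add: inH_eq_inK)
    qed
    have cG: "c \<in> carrier prd" using a aH by simp
    obtain w where w: "w \<in> words" "g = cls w" using 7(2) by (auto simp: prd_carrier)
    obtain v where v: "set v \<subseteq> inH ` carrier H \<union> inK ` carrier K" "g = word_prod prd v"
      using cls_generated[OF w(1)] w(2) by auto
    have "c \<otimes>\<^bsub>prd\<^esub> word_prod prd v = word_prod prd v \<otimes>\<^bsub>prd\<^esub> c" using v(1)
    proof (induction v)
      case (Cons s v)
      have s: "s \<in> carrier prd" "set v \<subseteq> carrier prd" using Cons.prems by auto
      then have vG: "word_prod prd v \<in> carrier prd" by simp
      have "c \<otimes>\<^bsub>prd\<^esub> (s \<otimes>\<^bsub>prd\<^esub> word_prod prd v) = s \<otimes>\<^bsub>prd\<^esub> c \<otimes>\<^bsub>prd\<^esub> word_prod prd v"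
        using syl[of s] Cons.prems s vG cG by (simp flip: prd.m_assoc)
      also have "\<dots> = s \<otimes>\<^bsub>prd\<^esub> (word_prod prd v \<otimes>\<^bsub>prd\<^esub> c)"
        using Cons s vG cG by (simp add: prd.m_assoc)
      finally show ?case using s vG cG by (simp add: prd.m_assoc)
    qed (use cG in simp)
    then show ?case using v(2) by simp
  next
    case (8 g)
    then show ?case using cls_generated by (auto simp: prd_carrier)
  next
    case (9 x y)
    then obtain u v where uv: "u \<in> carrier H" "v \<in> carrier H" "x = inH u" "y = inH v" by auto
    \<comment> \<open>Nonconjugacy in the amalgam descends to the factor, where a separating
      quotient exists; \<open>p_quotient_extend\<close> and \<open>lift\<close> carry it back to the
      amalgam.\<close>
    then have "\<not> conj_in H u v" using h.conj_in_hom 9(3) by auto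
    then obtain Q \<alpha> where Q: "p_quotient p H Q \<alpha>" "\<not> conj_in Q (\<alpha> u) (\<alpha> v)"
      using sH[OF uv(1,2)] by (auto simp: p_conj_separated_def)
    show ?case
    proof (rule p_quotient_extend[OF p gH gK A B iso sepB Q(1)])
      fix P :: "(nat \<times> nat) set monoid" and \<alpha>' \<beta>'
      assume P: "finite_p_group p P" "\<alpha>' \<in> hom H P" "\<beta>' \<in> hom K P" "\<And>a. a \<in> A \<Longrightarrow> \<alpha>' a = \<beta>' (\<phi> a)"
        and c: "\<And>x y. x \<in> carrier H \<Longrightarrow> y \<in> carrier H \<Longrightarrow> conj_in P (\<alpha>' x) (\<alpha>' y) \<Longrightarrow> conj_in Q (\<alpha> x) (\<alpha> y)"
      have gP: "group P" using P(1) by (simp add: finite_p_group_def)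
      obtain \<psi> where \<psi>: "\<psi> \<in> hom prd P" "\<forall>h\<in>carrier H. \<psi> (inH h) = \<alpha>' h"
        using lift[OF gP P(2-4)] by auto
      have "\<not> conj_in P (\<psi> x) (\<psi> y)" using c[OF uv(1,2)] Q(2) uv \<psi>(2) by auto
      then show "p_conj_separated p prd x y"
        using p_conj_separatedI[OF prd.is_group p P(1) \<psi>(1)] uv by simp
    qed
  next
    case (10 x y)
    then obtain u v where uv: "u \<in> carrier K" "v \<in> carrier K" "x = inK u" "y = inK v" by auto
    then have "\<not> conj_in K u v" using k.conj_in_hom 10(3) by auto
    then obtain Q \<alpha> where Q: "p_quotient p K Q \<alpha>" "\<not> conj_in Q (\<alpha> u) (\<alpha> v)"
      using sK[OF uv(1,2)] by (auto simp: p_conj_separated_def)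
    show ?case
    proof (rule p_quotient_extend[OF p gK gH B A \<chi> sepA Q(1)])
      fix P :: "(nat \<times> nat) set monoid" and \<beta>' \<alpha>'
      assume P: "finite_p_group p P" "\<beta>' \<in> hom K P" "\<alpha>' \<in> hom H P" "\<And>b. b \<in> B \<Longrightarrow> \<beta>' b = \<alpha>' (\<chi> b)"
        and c: "\<And>x y. x \<in> carrier K \<Longrightarrow> y \<in> carrier K \<Longrightarrow> conj_in P (\<beta>' x) (\<beta>' y) \<Longrightarrow> conj_in Q (\<alpha> x) (\<alpha> y)"
      have agree: "\<alpha>' a = \<beta>' (\<phi> a)" if "a \<in> A" for a
        using P(4)[of "\<phi> a"] \<chi>\<phi>[OF that] that \<phi>AB by auto
      have gP: "group P" using P(1) by (simp add: finite_p_group_def)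
      obtain \<psi> where \<psi>: "\<psi> \<in> hom prd P" "\<forall>k\<in>carrier K. \<psi> (inK k) = \<beta>' k"
        using lift[OF gP P(3,2) agree] by auto
      have "\<not> conj_in P (\<psi> x) (\<psi> y)" using c[OF uv(1,2)] Q(2) uv \<psi>(2) by auto
      then show "p_conj_separated p prd x y"
        using p_conj_separatedI[OF prd.is_group p P(1) \<psi>(1)] uv by simp
    qed
  next
    case (11 x)
    then obtain u where u: "u \<in> carrier H" "x = inH u" by auto
    have "u \<notin> A" using 11 u inH_eq_inK \<phi>_carrier by auto
    show ?case
    proof (rule quotient_killing_central[OF p gH A sepA u(1) \<open>u \<notin> A\<close>])
      \<comment> \<open>Since \<open>\<alpha>\<close> kills \<open>A\<close>, it is compatible with
        the trivial map on \<open>K\<close>, and the two extend to the amalgam.\<close>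
      fix P :: "nat set monoid" and \<alpha>
      assume P: "finite_p_group p P" "\<alpha> \<in> hom H P" "\<alpha> u \<noteq> \<one>\<^bsub>P\<^esub>" "\<And>a. a \<in> A \<Longrightarrow> \<alpha> a = \<one>\<^bsub>P\<^esub>"
      interpret P: group P using P(1) by (simp add: finite_p_group_def)
      have "(\<lambda>_. \<one>\<^bsub>P\<^esub>) \<in> hom K P" by (auto simp: hom_def)
      from lift[OF P.is_group P(2) this P(4)] obtain \<psi> where \<psi>: "\<psi> \<in> hom prd P"
        "\<forall>h\<in>carrier H. \<psi> (inH h) = \<alpha> h" "\<forall>k\<in>carrier K. \<psi> (inK k) = \<one>\<^bsub>P\<^esub>"
        by auto
      show "\<exists>Q \<psi>. p_quotient p prd Q \<psi> \<and> \<psi> x \<noteq> \<one>\<^bsub>Q\<^esub> \<and> (\<forall>k\<in>inK ` carrier K. \<psi> k = \<one>\<^bsub>Q\<^esub>)"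
        by (rule kill[OF P(1) \<psi>(1)]) (use u \<psi>(2,3) P(3) in auto)
    qed
  next
    case (12 x)
    then obtain u where u: "u \<in> carrier K" "x = inK u" by auto
    have "u \<notin> B"
    proof
      assume "u \<in> B"
      then obtain a where "a \<in> A" "u = \<phi> a" using \<phi>AB by auto
      then have "x = inH a" "a \<in> carrier H" using u(2) A'(2) by (auto simp: inH_eq_inK)
      then show False using 12 by simp
    qed
    show ?case
    proof (rule quotient_killing_central[OF p gK B sepB u(1) \<open>u \<notin> B\<close>])
      fix P :: "nat set monoid" and \<beta>
      assume P: "finite_p_group p P" "\<beta> \<in> hom K P" "\<beta> u \<noteq> \<one>\<^bsub>P\<^esub>" "\<And>b. b \<in> B \<Longrightarrow> \<beta> b = \<one>\<^bsub>P\<^esub>"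
      interpret P: group P using P(1) by (simp add: finite_p_group_def)
      have one: "(\<lambda>_. \<one>\<^bsub>P\<^esub>) \<in> hom H P" by (auto simp: hom_def)
      have agree: "\<one>\<^bsub>P\<^esub> = \<beta> (\<phi> a)" if "a \<in> A" for a using P(4)[of "\<phi> a"] that \<phi>AB by auto
      from lift[OF P.is_group one P(2) agree] obtain \<psi> where \<psi>: "\<psi> \<in> hom prd P"
        "\<forall>h\<in>carrier H. \<psi> (inH h) = \<one>\<^bsub>P\<^esub>" "\<forall>k\<in>carrier K. \<psi> (inK k) = \<beta> k"
        by auto
      show "\<exists>Q \<psi>. p_quotient p prd Q \<psi> \<and> \<psi> x \<noteq> \<one>\<^bsub>Q\<^esub> \<and> (\<forall>k\<in>inH ` carrier H. \<psi> k = \<one>\<^bsub>Q\<^esub>)"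
        by (rule kill[OF P(1) \<psi>(1)]) (use u \<psi>(2,3) P(3) in auto)
    qed
  next
    case (13 W \<alpha> \<beta>)
    have a: "\<alpha> \<circ> inH \<in> hom H W"
      using 13(2) by (auto simp: hom_def)
    have b: "\<beta> \<circ> inK \<in> hom K W"
      using 13(3) by (auto simp: hom_def)
    have c: "(\<alpha> \<circ> inH) a = (\<beta> \<circ> inK) (\<phi> a)" if "a \<in> A" for a
      using 13(4)[of "inH a"] that by (simp add: inH_eq_inK)
    from lift[OF 13(1) a b c] obtain \<psi> where "\<psi> \<in> hom prd W"
      "\<forall>h\<in>carrier H. \<psi> (inH h) = (\<alpha> \<circ> inH) h" "\<forall>k\<in>carrier K. \<psi> (inK k) = (\<beta> \<circ> inK) k"
      by auto
    then show ?case by (intro bexI[of _ \<psi>]) auto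
  qed
  show ?thesis by (rule conj_p_separable)
qed

end
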